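(* Let $S$ be a finite set, and let $\{\mu_n\}$ be a sequence of measures on $S^{V_n}$ satisfying the spatial Markov property, on the sequence of tori $V_n=\mathbb Z_n^d$ or on the sequence of boxes $V_n=[0,n]^d$, such that the Strong Spatial Mixing property holds. Then there is no random sparse reconstruction for $\{\mu_n\}$.
   Context: $\mathbb Z_n^d$ and $[0,n]^d$ (lattice points) carry the nearest-neighbour graph structure. For $\Lambda\subseteq V_n$, $\partial\Lambda$ is the external vertex boundary (vertices outside $\Lambda$ adjacent to some vertex of $\Lambda$). Spatial Markov property: for every $\Lambda\subseteq V_n$, conditionally on the configuration on $\partial\Lambda$, the configuration in $\Lambda$ is independent of the configuration outside $\Lambda\cup\partial\Lambda$. Any configuration $\psi\in S^{\partial\Lambda}$ is called a boundary condition. Strong Spatial Mixing (on cubes): there exist $a,b>0$ (not depending on $n$) such that for every $d$-dimensional cube $\Lambda\subseteq V_n$, every $u\in\partial\Lambda$, every pair of boundary conditions $\psi,\psi_u\in S^{\partial\Lambda}$ that are equal everywhere except at $u$, and every $B\subseteq\Lambda$, $$\|\mu_B^{\psi}-\mu_B^{\psi_u}\|_{TV}\le b\exp(-a\cdot d(u,B)),$$ where $\mu_B^{\psi}$ and $\mu_B^{\psi_u}$ are the measures on $S^B$ induced by the boundary conditions $\psi$ and $\psi_u$ on $\partial\Lambda$, $\|\cdot\|_{TV}$ is total variation distance, and $d(u,B)$ is graph distance. Clue: $\mathsf{clue}(f\,|\,U):=\mathrm{Var}(\mathbb E[f\,|\,\mathcal F_U])/\mathrm{Var}(f)$, where $\mathcal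 F_U$ is generated by the coordinates in $U$ (clue $=0$ if $\mathrm{Var}(f)=0$). There is random sparse reconstruction for $\{(S^{V_n},\mu_n)\}$ if there exist Boolean functions $f_n:S^{V_n}\to\{-1,1\}$, random subsets $\mathcal U_n\subseteq V_n$ independent of the spin system with revealment $\delta_n:=\max_{j\in V_n}\mathbb P[j\in\mathcal U_n]\to0$, and $c>0$ such that $\mathbb E[\mathsf{clue}(f_n\,|\,\mathcal U_n)]>c$ for all $n$. *)

theory Defs
  imports "HOL-Probability.Probability"
begin

text \<open>
  The dimension \<open>d\<close> is the cardinality of the finite index type \<open>'d\<close>, so \<open>d \<ge> 1\<close>.  Both families
  of graphs live on subsets of \<open>'d \<Rightarrow> int\<close>; \<open>Z_n\<close> is represented by the residues \<open>0, \<dots>, n - 1\<close>,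
  and sequences are indexed by \<open>n \<ge> 1\<close>.
\<close>

type_synonym 'd vertex = "'d \<Rightarrow> int"

datatype geometry = Torus | Box

fun verts :: "geometry \<Rightarrow> nat \<Rightarrow> 'd vertex set" where
  "verts Torus n = {x. \<forall>i. 0 \<le> x i \<and> x i < int n}"
| "verts Box n = {x. \<forall>i. 0 \<le> x i \<and> x i \<le> int n}"

fun adj :: "geometry \<Rightarrow> nat \<Rightarrow> 'd vertex \<Rightarrow> 'd vertex \<Rightarrow> bool" where
  "adj Torus n x y \<longleftrightarrow> x \<noteq> y \<and> (\<exists>i. (\<forall>j. j \<noteq> i \<longrightarrow> x j = y j) \<and>
     (y i mod int n = (x i + 1) mod int n \<or> x i mod int n = (y i + 1) mod int n))"
| "adj Box n x y \<longleftrightarrow> (\<exists>i. (\<forall>j. j \<noteq> i \<longrightarrow> x j = y j) \<and> \<bar>x i - y i\<bar> = 1)"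

definition edges :: "geometry \<Rightarrow> nat \<Rightarrow> ('d vertex \<times> 'd vertex) set" where
  "edges g n = {(x, y). x \<in> verts g n \<and> y \<in> verts g n \<and> adj g n x y}"

definition ext_boundary :: "('v \<times> 'v) set \<Rightarrow> 'v set \<Rightarrow> 'v set" where
  "ext_boundary E \<Lambda> = E `` \<Lambda> - \<Lambda>"

definition graph_dist :: "('v \<times> 'v) set \<Rightarrow> 'v \<Rightarrow> 'v \<Rightarrow> nat" where
  "graph_dist E x y = (LEAST k. (x, y) \<in> E ^^ k)"

text \<open>
  The infimum over the empty set is \<open>0\<close> here.  This is immaterial in the mixing condition below,
  where the total variation distance vanishes for \<open>B = {}\<close>.
\<close>

definition graph_set_dist :: "('v \<times> 'v) set \<Rightarrow> 'v \<Rightarrow> 'v set \<Rightarrow> nat" where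
  "graph_set_dist E u B = (INF v\<in>B. graph_dist E u v)"

definition cube :: "'d vertex \<Rightarrow> nat \<Rightarrow> 'd vertex set" where
  "cube a k = {x. \<forall>i. a i \<le> x i \<and> x i < a i + int k}"

text \<open>Cubes in the torus may wrap around.\<close>

fun cubes :: "geometry \<Rightarrow> nat \<Rightarrow> 'd vertex set set" where
  "cubes Torus n = {(\<lambda>x i. x i mod int n) ` cube a k | a k. 1 \<le> k \<and> k \<le> n}"
| "cubes Box n = {cube a k | a k. 1 \<le> k \<and> cube a k \<subseteq> verts Box n}"

text \<open>
  A configuration in \<open>S\<^sup>V\<close> is an element of \<open>V \<rightarrow>\<^sub>E S\<close>.  As \<open>S\<^sup>V\<close> is finite, a probability measure on
  it is a \<open>pmf\<close> supported there.
\<close>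

definition config_event :: "'v set \<Rightarrow> ('v \<Rightarrow> 's) \<Rightarrow> ('v \<Rightarrow> 's) set" where
  "config_event W \<psi> = {\<sigma>. restrict \<sigma> W = \<psi>}"

definition spatial_markov ::
  "'v set \<Rightarrow> ('v \<times> 'v) set \<Rightarrow> 's set \<Rightarrow> ('v \<Rightarrow> 's) pmf \<Rightarrow> bool" where
  "spatial_markov V E S \<mu> \<longleftrightarrow>
     (\<forall>\<Lambda> \<subseteq> V. \<forall>\<psi> \<in> ext_boundary E \<Lambda> \<rightarrow>\<^sub>E S.
        measure_pmf.prob \<mu> (config_event (ext_boundary E \<Lambda>) \<psi>) > 0 \<longrightarrow>
        prob_space.indep_var
          (measure_pmf (cond_pmf \<mu> (config_event (ext_boundary E \<Lambda>) \<psi>)))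
          (count_space UNIV) (\<lambda>\<sigma>. restrict \<sigma> \<Lambda>)
          (count_space UNIV) (\<lambda>\<sigma>. restrict \<sigma> (V - (\<Lambda> \<union> ext_boundary E \<Lambda>))))"

text \<open>
  A family of laws on \<open>S\<^sup>\<Lambda>\<close> induced by the boundary conditions on \<open>\<partial>\<Lambda>\<close>, that is, a version of the
  conditional law of the configuration in \<open>\<Lambda>\<close> given the one on \<open>\<partial>\<Lambda>\<close>.  The family is determined by
  \<open>\<mu>\<close> at every boundary condition of positive probability.  At the others it is only required to be
  some probability measure on \<open>S\<^sup>\<Lambda>\<close>; those boundary conditions still take part in the mixing
  condition, so systems without full support are not excluded.
\<close>

definition boundary_laws ::
  "'v set \<Rightarrow> ('v \<times> 'v) set \<Rightarrow> 's set \<Rightarrow> ('v \<Rightarrow> 's) pmf \<Rightarrow>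
    ('v set \<Rightarrow> ('v \<Rightarrow> 's) \<Rightarrow> ('v \<Rightarrow> 's) pmf) \<Rightarrow> bool" where
  "boundary_laws V E S \<mu> \<kappa> \<longleftrightarrow>
     (\<forall>\<Lambda> \<subseteq> V. \<forall>\<psi> \<in> ext_boundary E \<Lambda> \<rightarrow>\<^sub>E S.
        set_pmf (\<kappa> \<Lambda> \<psi>) \<subseteq> \<Lambda> \<rightarrow>\<^sub>E S \<and>
        (measure_pmf.prob \<mu> (config_event (ext_boundary E \<Lambda>) \<psi>) > 0 \<longrightarrow>
           \<kappa> \<Lambda> \<psi> = map_pmf (\<lambda>\<sigma>. restrict \<sigma> \<Lambda>)
             (cond_pmf \<mu> (config_event (ext_boundary E \<Lambda>) \<psi>))))"

definition total_variation :: "'a pmf \<Rightarrow> 'a pmf \<Rightarrow> real" where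
  "total_variation p q = (SUP A. \<bar>measure_pmf.prob p A - measure_pmf.prob q A\<bar>)"

definition marginal :: "'v set \<Rightarrow> ('v \<Rightarrow> 's) pmf \<Rightarrow> ('v \<Rightarrow> 's) pmf" where
  "marginal B p = map_pmf (\<lambda>\<sigma>. restrict \<sigma> B) p"

definition strong_spatial_mixing ::
  "geometry \<Rightarrow> 's set \<Rightarrow> (nat \<Rightarrow> ('d vertex \<Rightarrow> 's) pmf) \<Rightarrow> bool" where
  "strong_spatial_mixing g S \<mu> \<longleftrightarrow>
     (\<exists>\<kappa>. (\<forall>n\<ge>1. boundary_laws (verts g n) (edges g n) S (\<mu> n) (\<kappa> n)) \<and>
       (\<exists>a>0. \<exists>b>0. \<forall>n\<ge>1. \<forall>\<Lambda> \<in> cubes g n.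
          \<forall>u \<in> ext_boundary (edges g n) \<Lambda>.
          \<forall>\<psi> \<in> ext_boundary (edges g n) \<Lambda> \<rightarrow>\<^sub>E S.
          \<forall>\<psi>' \<in> ext_boundary (edges g n) \<Lambda> \<rightarrow>\<^sub>E S.
            (\<forall>v \<in> ext_boundary (edges g n) \<Lambda> - {u}. \<psi> v = \<psi>' v) \<longrightarrow>
            (\<forall>B \<subseteq> \<Lambda>.
               total_variation (marginal B (\<kappa> n \<Lambda> \<psi>)) (marginal B (\<kappa> n \<Lambda> \<psi>'))
                 \<le> b * exp (- a * real (graph_set_dist (edges g n) u B)))))"

definition coord_algebra :: "'v set \<Rightarrow> ('v \<Rightarrow> 's) measure" where
  "coord_algebra U = sigma UNIV {(\<lambda>\<sigma>. \<sigma> v) -` A | v A. v \<in> U}"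

text \<open>Division by zero gives \<open>0\<close>, so the clue of a function of zero variance is \<open>0\<close>.\<close>

definition clue :: "('v \<Rightarrow> 's) pmf \<Rightarrow> (('v \<Rightarrow> 's) \<Rightarrow> real) \<Rightarrow> 'v set \<Rightarrow> real" where
  "clue \<mu> f U =
     measure_pmf.variance \<mu> (real_cond_exp (measure_pmf \<mu>) (coord_algebra U) f)
       / measure_pmf.variance \<mu> f"

definition revealment :: "'v set \<Rightarrow> 'v set pmf \<Rightarrow> real" where
  "revealment V \<U> = Max ((\<lambda>j. measure_pmf.prob \<U> {U. j \<in> U}) ` V)"

text \<open>
  The random set is independent of the spin system, so only its law \<open>\<U> n\<close> matters, and the expected
  clue is the average of the clue of a fixed set under \<open>\<U> n\<close>.
\<close>

definition random_sparse_reconstruction ::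
  "(nat \<Rightarrow> 'v set) \<Rightarrow> 's set \<Rightarrow> (nat \<Rightarrow> ('v \<Rightarrow> 's) pmf) \<Rightarrow> bool" where
  "random_sparse_reconstruction V S \<mu> \<longleftrightarrow>
     (\<exists>f \<U>. \<exists>c>0.
        (\<forall>n\<ge>1. f n \<in> (V n \<rightarrow>\<^sub>E S) \<rightarrow> {-1, 1}) \<and>
        (\<forall>n\<ge>1. set_pmf (\<U> n) \<subseteq> Pow (V n)) \<and>
        (\<lambda>n. revealment (V n) (\<U> n)) \<longlonglongrightarrow> 0 \<and>
        (\<forall>n\<ge>1. measure_pmf.expectation (\<U> n) (clue (\<mu> n) (f n)) > c))"

end

theory Submission
  imports Defs
begin

text \<open>
  Resampling a cube \<open>C\<close> from its boundary law is an orthogonal projection \<open>K\<^sub>C\<close> in \<open>L\<^sup>2(\<mu>)\<close>.  Fix a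
  sequence of cubes \<open>C\<^sub>1, C\<^sub>2, \<dots>\<close>, put \<open>f\<^sub>t = K\<^bsub>C\<^sub>t\<^esub> f\<^bsub>t-1\<^esub>\<close>, and let \<open>h\<close> be a function of the coordinates in
  \<open>U\<close>.  In each step \<open>\<langle>f, h\<rangle>\<close> loses the inner product of the two increments, which vanishes unless the
  cube meets the set of coordinates on which the current \<open>h\<close> depends.  Hence \<open>\<langle>f, h\<rangle>\<^sup>2 \<le> \<parallel>h\<parallel>\<^sup>2 W\<close>, where \<open>W\<close>
  is \<open>\<parallel>f\<^sub>T\<parallel>\<^sup>2\<close> plus the sum of \<open>\<parallel>f\<^bsub>t-1\<^esub> - f\<^sub>t\<parallel>\<^sup>2\<close> over the steps of the latter kind.  For random \<open>U\<close> of
  small revealment each such step is unlikely, as long as the cubes come in boundedly many rounds of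
  well separated cubes.  So the expected clue is small once \<open>\<parallel>f\<^sub>T\<parallel>\<^sup>2 \<le> \<epsilon> \<parallel>f\<parallel>\<^sup>2\<close> after a number of rounds
  independent of \<open>n\<close>.

  For this contraction the cubes of a round are placed at random, so that a fixed vertex is much more
  often inside a cube than on its boundary.  Strong spatial mixing then makes the averaged symmetrised
  round contract the Lipschitz constant with respect to the Hamming distance by a factor \<open>\<rho> < 1\<close> (path
  coupling).  As the averaged operator is self-adjoint, it contracts mean-zero functions in \<open>L\<^sup>2(\<mu>)\<close> by
  the same factor, so some round satisfies \<open>\<parallel>K f\<parallel>\<^sup>2 \<le> \<rho> \<parallel>f\<parallel>\<^sup>2\<close>.
\<close>

section \<open>Resampling a block from its boundary law\<close>

lemma expectation_bind_pmf_finite: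
  fixes f :: "'b \<Rightarrow> real"
  assumes "finite (set_pmf M)" "\<And>x. x \<in> set_pmf M \<Longrightarrow> finite (set_pmf (N x))"
  shows "measure_pmf.expectation (bind_pmf M N) f =
    measure_pmf.expectation M (\<lambda>x. measure_pmf.expectation (N x) f)"
  using assms by (subst pmf_expectation_bind[of "set_pmf M"], simp_all)
    (subst integral_measure_pmf[of "set_pmf M"], auto)

lemma expectation_cong_pmf:
  assumes "\<And>x. x \<in> set_pmf M \<Longrightarrow> f x = g x"
  shows "measure_pmf.expectation M f = measure_pmf.expectation M g"
  using assms by (intro integral_cong_AE) (auto simp: AE_measure_pmf_iff)

lemma expectation_mono_pmf:
  fixes f g :: "'a \<Rightarrow> real"
  assumes "finite (set_pmf M)" "\<And>x. x \<in> set_pmf M \<Longrightarrow> f x \<le> g x"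
  shows "measure_pmf.expectation M f \<le> measure_pmf.expectation M g"
  using assms by (intro integral_mono_AE integrable_measure_pmf_finite) (auto simp: AE_measure_pmf_iff)

lemma expectation_diff_le:
  fixes f g :: "'a \<Rightarrow> real"
  assumes fin: "finite (set_pmf M)" and "\<And>x. x \<in> set_pmf M \<Longrightarrow> \<bar>f x - g x\<bar> \<le> c"
  shows "\<bar>measure_pmf.expectation M f - measure_pmf.expectation M g\<bar> \<le> c"
proof -
  have i: "integrable (measure_pmf M) h" for h :: "'a \<Rightarrow> real"
    using fin by (rule integrable_measure_pmf_finite)
  have "measure_pmf.expectation M (\<lambda>x. f x - g x) \<le> measure_pmf.expectation M (\<lambda>_. c)"
    using assms(2) by (intro expectation_mono_pmf fin) (simp add: abs_le_iff)
  moreover have "measure_pmf.expectation M (\<lambda>x. - (f x - g x)) \<le> measure_pmf.expectation M (\<lambda>_. c)"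
    using assms(2) by (intro expectation_mono_pmf fin) (simp add: abs_le_iff)
  ultimately have "\<bar>measure_pmf.expectation M (\<lambda>x. f x - g x)\<bar> \<le> c"
    by (simp add: i abs_le_iff)
  then show ?thesis by (simp add: i)
qed

lemma total_variation_ge:
  "\<bar>measure_pmf.prob p A - measure_pmf.prob q A\<bar> \<le> total_variation p q"
proof -
  have "bdd_above (range (\<lambda>A. \<bar>measure_pmf.prob p A - measure_pmf.prob q A\<bar>))"
  proof (rule bdd_aboveI2)
    show "\<bar>measure_pmf.prob p A - measure_pmf.prob q A\<bar> \<le> 1" for A
      using measure_pmf.prob_le_1[of p A] measure_pmf.prob_le_1[of q A]
        measure_nonneg[of p A] measure_nonneg[of q A] by linarith
  qed
  then show ?thesis unfolding total_variation_def by (rule cSUP_upper2) auto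
qed

text \<open>After subtracting its minimum \<open>m\<close> over the joint support, \<open>f\<close>
  takes values between 0 and \<open>w\<close>. Dropping the points where \<open>q\<close> exceeds
  \<open>p\<close> leaves at most \<open>w\<close> times the excess of \<open>p\<close> over
  \<open>q\<close> on \<open>A\<close>.\<close>

lemma expectation_diff_le_total_variation:
  fixes f :: "'a \<Rightarrow> real"
  assumes fin: "finite (set_pmf p)" "finite (set_pmf q)"
    and osc: "\<And>x y. x \<in> set_pmf p \<union> set_pmf q \<Longrightarrow> y \<in> set_pmf p \<union> set_pmf q \<Longrightarrow> \<bar>f x - f y\<bar> \<le> w"
  shows "\<bar>measure_pmf.expectation p f - measure_pmf.expectation q f\<bar> \<le> w * total_variation p q"
proof -
  have one_sided: "measure_pmf.expectation p f - measure_pmf.expectation q f \<le> w * total_variation p q"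
    if fin: "finite (set_pmf p)" "finite (set_pmf q)"
      and osc: "\<And>x y. x \<in> set_pmf p \<union> set_pmf q \<Longrightarrow> y \<in> set_pmf p \<union> set_pmf q \<Longrightarrow> \<bar>f x - f y\<bar> \<le> w"
    for p q :: "'a pmf"
  proof -
    define X where "X = set_pmf p \<union> set_pmf q"
    define A where "A = {x \<in> X. pmf q x \<le> pmf p x}"
    define m where "m = Min (f ` X)"
    have X: "finite X" "X \<noteq> {}" using fin set_pmf_not_empty[of p] by (auto simp: X_def)
    have m: "m \<le> f x" "f x \<le> m + w" if "x \<in> X" for x
    proof -
      show "m \<le> f x" using X that by (simp add: m_def)
      have "m \<in> f ` X" unfolding m_def using X by (intro Min_in) auto
      then obtain y where "y \<in> X" "m = f y" by auto
      then show "f x \<le> m + w" using osc[of x y] that by (auto simp: X_def)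
    qed
    have E: "measure_pmf.expectation r f = (\<Sum>x\<in>X. f x * pmf r x)" if "set_pmf r \<subseteq> X" for r
      using that X by (intro integral_measure_pmf_real) auto
    have S: "(\<Sum>x\<in>X. pmf r x) = 1" if "set_pmf r \<subseteq> X" for r
      using that X by (intro sum_pmf_eq_1) auto
    have pX: "set_pmf p \<subseteq> X" "set_pmf q \<subseteq> X" by (auto simp: X_def)
    have "measure_pmf.expectation p f - measure_pmf.expectation q f
        = (\<Sum>x\<in>X. (f x - m) * (pmf p x - pmf q x))"
      using S[OF pX(1)] S[OF pX(2)]
      by (simp add: E pX algebra_simps sum_subtractf sum.distrib flip: sum_distrib_left)
    also have "\<dots> \<le> (\<Sum>x\<in>X. if x \<in> A then w * (pmf p x - pmf q x) else 0)"
    proof (rule sum_mono)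
      fix x assume x: "x \<in> X"
      show "(f x - m) * (pmf p x - pmf q x) \<le> (if x \<in> A then w * (pmf p x - pmf q x) else 0)"
        using m[OF x] x by (auto simp: A_def intro!: mult_right_mono mult_nonneg_nonpos)
    qed
    also have "\<dots> = w * ((\<Sum>x\<in>A. pmf p x) - (\<Sum>x\<in>A. pmf q x))"
      using X by (simp add: sum.If_cases A_def Int_def sum_subtractf flip: sum_distrib_left)
    also have "\<dots> = w * (measure_pmf.prob p A - measure_pmf.prob q A)"
      using X by (simp add: measure_measure_pmf_finite A_def)
    also have "\<dots> \<le> w * total_variation p q"
    proof (rule mult_left_mono)
      show "measure_pmf.prob p A - measure_pmf.prob q A \<le> total_variation p q"
        using total_variation_ge[of p A q] by linarith
      obtain z where "z \<in> X" using X(2) by auto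
      then show "0 \<le> w" using osc[of z z] by (simp add: X_def)
    qed
    finally show ?thesis .
  qed
  have "total_variation q p = total_variation p q"
    unfolding total_variation_def by (simp add: abs_minus_commute)
  then show ?thesis
    using one_sided[OF fin osc] one_sided[OF fin(2,1), unfolded Un_commute[of "set_pmf q"], OF osc]
    by (simp add: abs_le_iff)
qed

section \<open>Spin systems and invariance under block resampling\<close>

locale spin_system =
  fixes V :: "'v set" and E :: "('v \<times> 'v) set" and S :: "'s set"
    and \<mu> :: "('v \<Rightarrow> 's) pmf" and \<kappa> :: "'v set \<Rightarrow> ('v \<Rightarrow> 's) \<Rightarrow> ('v \<Rightarrow> 's) pmf"
  assumes finite_V: "finite V" and finite_S: "finite S" and E_V: "E \<subseteq> V \<times> V"
    and supp: "set_pmf \<mu> \<subseteq> V \<rightarrow>\<^sub>E S"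
    and markov: "spatial_markov V E S \<mu>"
    and laws: "boundary_laws V E S \<mu> \<kappa>"
begin

abbreviation \<Omega> where "\<Omega> \<equiv> V \<rightarrow>\<^sub>E S"
abbreviation bd where "bd \<equiv> ext_boundary E"

text \<open>A version of the conditional expectation given the configuration off \<open>C\<close>.
  The oscillation bounds below also compare configurations of probability zero, so it is evaluated
  through \<open>\<kappa>\<close> there as well.\<close>

definition heat :: "'v set \<Rightarrow> (('v \<Rightarrow> 's) \<Rightarrow> real) \<Rightarrow> ('v \<Rightarrow> 's) \<Rightarrow> real" where
  "heat C f x = measure_pmf.expectation (\<kappa> C (restrict x (bd C))) (\<lambda>\<eta>. f (override_on x \<eta> C))"

lemma finite_\<Omega>: "finite \<Omega>" using finite_V finite_S by (simp add: finite_PiE)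

lemma finite_supp: "finite (set_pmf \<mu>)" using supp finite_\<Omega> by (rule finite_subset)

lemma integrable_\<mu> [simp]: "integrable (measure_pmf \<mu>) (f :: _ \<Rightarrow> real)"
  using finite_supp by (rule integrable_measure_pmf_finite)

lemma bd_subset: "bd C \<subseteq> V - C" using E_V by (auto simp: ext_boundary_def)

lemma restrict_bd: "x \<in> \<Omega> \<Longrightarrow> restrict x (bd C) \<in> bd C \<rightarrow>\<^sub>E S"
  using bd_subset[of C] by (auto simp: PiE_iff)

lemma set_\<kappa>:
  assumes "C \<subseteq> V" "x \<in> \<Omega>"
  shows "set_pmf (\<kappa> C (restrict x (bd C))) \<subseteq> C \<rightarrow>\<^sub>E S"
  using laws assms restrict_bd unfolding boundary_laws_def by blast

lemma finite_set_\<kappa>: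
  assumes "C \<subseteq> V" "x \<in> \<Omega>"
  shows "finite (set_pmf (\<kappa> C (restrict x (bd C))))"
  by (rule finite_subset[OF set_\<kappa>[OF assms]])
    (use finite_subset[OF assms(1) finite_V] finite_S in \<open>simp add: finite_PiE\<close>)

lemma override_in: "C \<subseteq> V \<Longrightarrow> x \<in> \<Omega> \<Longrightarrow> \<eta> \<in> C \<rightarrow>\<^sub>E S \<Longrightarrow> override_on x \<eta> C \<in> \<Omega>"
  by (auto simp: override_on_def PiE_iff extensional_def)

text \<open>Conditionally on the boundary, the configurations on \<open>C\<close> and
  \<open>W\<close> are independent, so the one on \<open>C\<close> may be replaced by an independent
  copy with the same conditional law. Averaging over the boundary configuration restores
  \<open>\<mu>\<close>.\<close>

lemma resample_invariant:
  assumes C: "C \<subseteq> V"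
  shows "bind_pmf \<mu> (\<lambda>y. map_pmf (\<lambda>\<eta>. override_on y \<eta> C) (\<kappa> C (restrict y (bd C)))) = \<mu>"
proof -
  define W where "W = V - (C \<union> bd C)"
  define b where "b = (\<lambda>x. restrict x (bd C) :: 'v \<Rightarrow> 's)"
  define upd where "upd = (\<lambda>\<psi> y. map_pmf (\<lambda>\<eta>. override_on y \<eta> C) (\<kappa> C \<psi>))"
  have ne: "set_pmf \<mu> \<inter> {y. b x = b y} \<noteq> {}" if "x \<in> set_pmf \<mu>" for x using that by auto
  \<comment> \<open>Disintegration of \<open>\<mu>\<close> along the configuration on
    \<open>bd C\<close>; invariance need only be shown for each conditional law.\<close>
  have cancel: "bind_pmf \<mu> (\<lambda>x. cond_pmf \<mu> {y. b x = b y}) = \<mu>"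
    by (rule bind_cond_pmf_cancel) (use ne in \<open>auto simp: eq_commute\<close>)
  have local: "bind_pmf (cond_pmf \<mu> {y. b x = b y}) (\<lambda>y. upd (b x) y) = cond_pmf \<mu> {y. b x = b y}"
    if x: "x \<in> set_pmf \<mu>" for x
  proof -
    define \<nu> where "\<nu> = cond_pmf \<mu> {y. b x = b y}"
    have ev: "{y. b x = b y} = config_event (bd C) (b x)"
      by (auto simp: config_event_def b_def)
    have x\<Omega>: "x \<in> \<Omega>" using x supp by auto
    have bx: "b x \<in> bd C \<rightarrow>\<^sub>E S" unfolding b_def using x\<Omega> by (rule restrict_bd)
    have pos: "measure_pmf.prob \<mu> (config_event (bd C) (b x)) > 0"
      unfolding ev[symmetric] using ne[OF x]
      by (subst zero_less_measure_iff) (auto simp: measure_pmf_zero_iff)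
    have ind: "prob_space.indep_var (measure_pmf \<nu>)
          (count_space UNIV) (\<lambda>\<sigma>. restrict \<sigma> C) (count_space UNIV) (\<lambda>\<sigma>. restrict \<sigma> W)"
      using markov C bx pos unfolding spatial_markov_def W_def \<nu>_def ev by blast
    have \<kappa>: "\<kappa> C (b x) = map_pmf (\<lambda>\<sigma>. restrict \<sigma> C) \<nu>"
      using laws C bx pos unfolding boundary_laws_def \<nu>_def ev by blast
    have pair: "map_pmf (\<lambda>\<sigma>. (restrict \<sigma> C, restrict \<sigma> W)) \<nu>
        = pair_pmf (map_pmf (\<lambda>\<sigma>. restrict \<sigma> C) \<nu>) (map_pmf (\<lambda>\<sigma>. restrict \<sigma> W) \<nu>)"
    proof (rule pmf_eqI)
      fix ac :: "('v \<Rightarrow> 's) \<times> ('v \<Rightarrow> 's)"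
      obtain a c where ac: "ac = (a, c)" by force
      have "measure_pmf.prob \<nu> ((\<lambda>\<sigma>. (restrict \<sigma> C, restrict \<sigma> W)) -` ({a} \<times> {c}))
        = measure_pmf.prob \<nu> ((\<lambda>\<sigma>. restrict \<sigma> C) -` {a}) * measure_pmf.prob \<nu> ((\<lambda>\<sigma>. restrict \<sigma> W) -` {c})"
        using prob_space.indep_varD[OF measure_pmf.prob_space_axioms ind, of "{a}" "{c}"] by simp
      then show "pmf (map_pmf (\<lambda>\<sigma>. (restrict \<sigma> C, restrict \<sigma> W)) \<nu>) ac =
          pmf (pair_pmf (map_pmf (\<lambda>\<sigma>. restrict \<sigma> C) \<nu>) (map_pmf (\<lambda>\<sigma>. restrict \<sigma> W) \<nu>)) ac"
        by (simp add: ac pmf_pair pmf_map)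
    qed
    \<comment> \<open>Glues the parts on \<open>C\<close>, on the boundary (fixed to
      \<open>b x\<close>) and on \<open>W\<close>, so that \<open>\<nu>\<close> is an image of the
      product law in \<open>pair\<close>.\<close>
    define rec :: "('v \<Rightarrow> 's) \<times> ('v \<Rightarrow> 's) \<Rightarrow> 'v \<Rightarrow> 's"
      where "rec = (\<lambda>(a, c) v. if v \<in> C then a v else if v \<in> bd C then b x v
                     else if v \<in> W then c v else undefined)"
    have set\<nu>: "set_pmf \<nu> = set_pmf \<mu> \<inter> {y. b x = b y}"
      unfolding \<nu>_def using ne[OF x] by (rule set_cond_pmf)
    have rec_override: "rec (a, restrict y W) = override_on y a C" if "y \<in> set_pmf \<nu>" for y a
    proof
      fix v
      have "y \<in> \<Omega>" "b x = b y" using that set\<nu> supp by auto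
      then show "rec (a, restrict y W) v = override_on y a C v"
        using C bd_subset[of C]
        by (auto simp: rec_def override_on_def W_def PiE_iff extensional_def b_def fun_eq_iff restrict_def)
    qed
    have "\<nu> = map_pmf rec (map_pmf (\<lambda>\<sigma>. (restrict \<sigma> C, restrict \<sigma> W)) \<nu>)"
    proof -
      have "rec (restrict \<sigma> C, restrict \<sigma> W) = \<sigma>" if "\<sigma> \<in> set_pmf \<nu>" for \<sigma>
        unfolding rec_override[OF that] by (auto simp: override_on_def)
      then have "map_pmf (\<lambda>\<sigma>. rec (restrict \<sigma> C, restrict \<sigma> W)) \<nu> = map_pmf id \<nu>"
        by (intro map_pmf_cong) auto
      then show ?thesis by (simp add: map_pmf_comp map_pmf_id)
    qed
    also have "\<dots> = map_pmf rec (pair_pmf (\<kappa> C (b x)) (map_pmf (\<lambda>\<sigma>. restrict \<sigma> W) \<nu>))"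
      unfolding pair \<kappa> ..
    also have "\<dots> = bind_pmf \<nu> (\<lambda>y. map_pmf (\<lambda>a. rec (a, restrict y W)) (\<kappa> C (b x)))"
      unfolding pair_pmf_def map_bind_pmf
      by (subst bind_commute_pmf) (simp add: bind_map_pmf map_bind_pmf map_pmf_def bind_assoc_pmf bind_return_pmf)
    also have "\<dots> = bind_pmf \<nu> (\<lambda>y. upd (b x) y)"
      unfolding upd_def using rec_override by (intro bind_pmf_cong) auto
    finally show ?thesis unfolding \<nu>_def ..
  qed
  have "bind_pmf \<mu> (\<lambda>y. upd (b y) y) = bind_pmf (bind_pmf \<mu> (\<lambda>x. cond_pmf \<mu> {y. b x = b y})) (\<lambda>y. upd (b y) y)"
    unfolding cancel ..
  also have "\<dots> = bind_pmf \<mu> (\<lambda>x. bind_pmf (cond_pmf \<mu> {y. b x = b y}) (\<lambda>y. upd (b y) y))"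
    by (simp add: bind_assoc_pmf)
  also have "\<dots> = bind_pmf \<mu> (\<lambda>x. bind_pmf (cond_pmf \<mu> {y. b x = b y}) (\<lambda>y. upd (b x) y))"
    by (intro bind_pmf_cong refl) (auto simp: set_cond_pmf[OF ne])
  also have "\<dots> = bind_pmf \<mu> (\<lambda>x. cond_pmf \<mu> {y. b x = b y})"
    using local by (intro bind_pmf_cong) auto
  finally show ?thesis unfolding cancel by (simp add: upd_def b_def)
qed

end

section \<open>Block projections and the covariance estimate\<close>

context spin_system
begin

definition ip :: "(('v \<Rightarrow> 's) \<Rightarrow> real) \<Rightarrow> (('v \<Rightarrow> 's) \<Rightarrow> real) \<Rightarrow> real" where
  "ip f g = measure_pmf.expectation \<mu> (\<lambda>x. f x * g x)"

abbreviation sqn :: "(('v \<Rightarrow> 's) \<Rightarrow> real) \<Rightarrow> real" where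
  "sqn f \<equiv> ip f f"

definition depends :: "'v set \<Rightarrow> (('v \<Rightarrow> 's) \<Rightarrow> real) \<Rightarrow> bool" where
  "depends U f \<longleftrightarrow> (\<forall>x\<in>\<Omega>. \<forall>y\<in>\<Omega>. (\<forall>v\<in>U. x v = y v) \<longrightarrow> f x = f y)"

lemma dependsD:
  "depends U f \<Longrightarrow> x \<in> \<Omega> \<Longrightarrow> y \<in> \<Omega> \<Longrightarrow> (\<And>v. v \<in> U \<Longrightarrow> x v = y v) \<Longrightarrow> f x = f y"
  unfolding depends_def by blast

lemma override_\<kappa>_in:
  assumes "C \<subseteq> V" "x \<in> \<Omega>" "\<eta> \<in> set_pmf (\<kappa> C (restrict x (bd C)))"
  shows "override_on x \<eta> C \<in> \<Omega>"
  by (rule override_in[OF assms(1,2)], rule subsetD[OF set_\<kappa>[OF assms(1,2)]], rule assms(3))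

lemma ip_commute: "ip f g = ip g f"
  by (simp add: ip_def mult.commute)

lemma ip_diff_left: "ip (\<lambda>x. f x - g x) h = ip f h - ip g h"
  by (simp add: ip_def left_diff_distrib)

lemma ip_diff_right: "ip h (\<lambda>x. f x - g x) = ip h f - ip h g"
  by (simp add: ip_def right_diff_distrib)

lemma ip_sum_left: "ip (\<lambda>x. \<Sum>i\<in>I. f i x) h = (\<Sum>i\<in>I. ip (f i) h)"
  by (simp add: ip_def sum_distrib_right)

lemma ip_cmult_left: "ip (\<lambda>x. c * f x) h = c * ip f h"
  by (simp add: ip_def mult.assoc)

lemma sqn_nonneg: "sqn f \<ge> 0"
  by (simp add: ip_def integral_nonneg_AE)

lemma Cauchy_Schwarz: "(ip f g)\<^sup>2 \<le> sqn f * sqn g"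
proof -
  have E: "ip f g = (\<Sum>x\<in>set_pmf \<mu>. (f x * sqrt (pmf \<mu> x)) * (g x * sqrt (pmf \<mu> x)))" for f g
    unfolding ip_def using finite_supp
    by (subst integral_measure_pmf_real[of "set_pmf \<mu>"]) (auto simp: mult_ac intro!: sum.cong)
  show ?thesis unfolding E power2_eq_square[symmetric, of "_ * sqrt _"] by (rule Cauchy_Schwarz_ineq_sum)
qed

lemma depends_mono: "depends U f \<Longrightarrow> U \<subseteq> W \<Longrightarrow> depends W f"
  unfolding depends_def by blast

lemma depends_V: "depends V f"
  unfolding depends_def
proof (intro ballI impI)
  fix x y assume "x \<in> \<Omega>" "y \<in> \<Omega>" "\<forall>v\<in>V. x v = y v"
  then have "x = y" by (intro PiE_ext[of x V "\<lambda>_. S" y]) auto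
  then show "f x = f y" by simp
qed

text \<open>The average removes the coordinates in \<open>C\<close>, while the choice of the law
  \<open>\<kappa> C\<close> brings in those of \<open>bd C\<close>.\<close>

lemma heat_depends:
  assumes C: "C \<subseteq> V" and U: "depends U f"
  shows "depends ((U - C) \<union> bd C) (heat C f)"
  unfolding depends_def
proof (intro ballI impI)
  fix x y assume xy: "x \<in> \<Omega>" "y \<in> \<Omega>" and eq: "\<forall>v\<in>(U - C) \<union> bd C. x v = y v"
  have r: "restrict x (bd C) = restrict y (bd C)" using eq by (auto simp: restrict_def)
  show "heat C f x = heat C f y"
    unfolding heat_def r
  proof (rule expectation_cong_pmf)
    fix \<eta> assume \<eta>: "\<eta> \<in> set_pmf (\<kappa> C (restrict y (bd C)))"
    show "f (override_on x \<eta> C) = f (override_on y \<eta> C)"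
    proof (rule dependsD[OF U])
      show "override_on x \<eta> C \<in> \<Omega>" "override_on y \<eta> C \<in> \<Omega>"
        using override_\<kappa>_in[OF C xy(1)] override_\<kappa>_in[OF C xy(2)] \<eta> r by simp_all
    qed (use eq in \<open>auto simp: override_on_def\<close>)
  qed
qed

lemma heat_depends_compl: "C \<subseteq> V \<Longrightarrow> depends (V - C) (heat C f)"
  by (rule depends_mono[OF heat_depends[OF _ depends_V]]) (use bd_subset in auto)

lemma heat_mult:
  assumes C: "C \<subseteq> V" and x: "x \<in> \<Omega>" and g: "depends (V - C) g"
  shows "heat C (\<lambda>x. f x * g x) x = heat C f x * g x"
proof -
  have "heat C (\<lambda>x. f x * g x) x
      = measure_pmf.expectation (\<kappa> C (restrict x (bd C))) (\<lambda>\<eta>. f (override_on x \<eta> C) * g x)"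
    unfolding heat_def
  proof (rule expectation_cong_pmf)
    fix \<eta> assume "\<eta> \<in> set_pmf (\<kappa> C (restrict x (bd C)))"
    from override_\<kappa>_in[OF C x this] have "g (override_on x \<eta> C) = g x"
      by (rule dependsD[OF g _ x]) auto
    then show "f (override_on x \<eta> C) * g (override_on x \<eta> C) = f (override_on x \<eta> C) * g x" by simp
  qed
  then show ?thesis by (simp add: heat_def)
qed

lemma heat_fixed:
  assumes C: "C \<subseteq> V" and x: "x \<in> \<Omega>" and g: "depends (V - C) g"
  shows "heat C g x = g x"
  using heat_mult[OF C x g, of "\<lambda>_. 1"] by (simp add: heat_def)

lemma expectation_heat:
  assumes C: "C \<subseteq> V"
  shows "measure_pmf.expectation \<mu> (heat C f) = measure_pmf.expectation \<mu> f"
proof -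
  have "measure_pmf.expectation \<mu> f = measure_pmf.expectation
      (bind_pmf \<mu> (\<lambda>y. map_pmf (\<lambda>\<eta>. override_on y \<eta> C) (\<kappa> C (restrict y (bd C))))) f"
    by (simp add: resample_invariant[OF C])
  also have "\<dots> = measure_pmf.expectation \<mu> (heat C f)"
    unfolding heat_def
    by (subst expectation_bind_pmf_finite) (use finite_supp finite_set_\<kappa>[OF C] supp in auto)
  finally show ?thesis ..
qed

lemma ip_heat:
  assumes C: "C \<subseteq> V" and g: "depends (V - C) g"
  shows "ip (heat C f) g = ip f g"
proof -
  have "ip (heat C f) g = measure_pmf.expectation \<mu> (heat C (\<lambda>x. f x * g x))"
    unfolding ip_def using heat_mult[OF C _ g] supp by (intro expectation_cong_pmf) auto
  also have "\<dots> = ip f g" unfolding ip_def by (rule expectation_heat[OF C])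
  finally show ?thesis .
qed

text \<open>Both sides equal \<open>ip (heat C f) (heat C g)\<close>, since \<open>ip_heat\<close>
  applies to either projected function.\<close>

lemma heat_selfadjoint: "C \<subseteq> V \<Longrightarrow> ip (heat C f) g = ip f (heat C g)"
  using ip_heat[of C "heat C g" f] ip_heat[of C "heat C f" g] heat_depends_compl[of C]
  by (simp add: ip_commute)

text \<open>Pythagoras for the projection \<open>heat C\<close>: the mixed terms vanish.\<close>

lemma ip_split:
  assumes C: "C \<subseteq> V"
  shows "ip f h = ip (heat C f) (heat C h) + ip (\<lambda>x. f x - heat C f x) (\<lambda>x. h x - heat C h x)"
proof -
  have "ip f (heat C h) = ip (heat C f) (heat C h)" "ip (heat C f) h = ip (heat C f) (heat C h)"
    using ip_heat[OF C heat_depends_compl[OF C, of h], of f]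
      ip_heat[OF C heat_depends_compl[OF C, of f], of h] by (simp_all add: ip_commute)
  then show ?thesis by (simp add: ip_diff_left ip_diff_right)
qed

text \<open>Adjoints reverse the order of the blocks, hence the symmetrised rounds
  \<open>R s @ rev (R s)\<close> below.\<close>

lemma fold_heat_adjoint:
  assumes "\<forall>C\<in>set Cs. C \<subseteq> V"
  shows "ip (fold heat Cs f) g = ip f (fold heat (rev Cs) g)"
  using assms
proof (induction Cs arbitrary: f)
  case (Cons C Cs)
  then show ?case using heat_selfadjoint[of C f] by simp
qed simp

lemma expectation_fold_heat:
  "\<forall>C\<in>set Cs. C \<subseteq> V \<Longrightarrow> measure_pmf.expectation \<mu> (fold heat Cs f) = measure_pmf.expectation \<mu> f"
  by (induction Cs arbitrary: f) (auto simp: expectation_heat)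

text \<open>\<open>touch C U\<close> is the set of coordinates that a function of the coordinates in \<open>U\<close> may depend on
  after resampling \<open>C\<close>.\<close>

definition touch :: "'v set \<Rightarrow> 'v set \<Rightarrow> 'v set" where
  "touch C U = (if U \<inter> C = {} then U else U \<union> bd C)"

text \<open>The quantity \<open>W\<close> of the introduction: an increment of \<open>f\<close> is
  charged only if its block meets the coordinates on which the current \<open>h\<close> may
  depend.\<close>

fun leak :: "'v set list \<Rightarrow> 'v set \<Rightarrow> (('v \<Rightarrow> 's) \<Rightarrow> real) \<Rightarrow> real" where
  "leak [] U f = sqn f"
| "leak (C # Cs) U f =
     (if U \<inter> C = {} then 0 else sqn (\<lambda>x. f x - heat C f x)) + leak Cs (touch C U) (heat C f)"

lemma leak_nonneg: "leak Cs U f \<ge> 0"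
  by (induction Cs arbitrary: U f) (auto simp: sqn_nonneg intro!: add_nonneg_nonneg)

text \<open>Induction along the blocks. A block missing \<open>U\<close> fixes \<open>h\<close>, so
  nothing is lost. Otherwise \<open>ip_split\<close> separates the projected parts, bounded by
  induction, from the increments, bounded by Cauchy-Schwarz.\<close>

lemma ip_sq_le_leak:
  assumes "\<forall>C\<in>set Cs. C \<subseteq> V" "depends U h" "U \<subseteq> V"
  shows "(ip f h)\<^sup>2 \<le> leak Cs U f * sqn h"
  using assms
proof (induction Cs arbitrary: U f h)
  case Nil
  then show ?case using Cauchy_Schwarz by simp
next
  case (Cons C Cs)
  then have C: "C \<subseteq> V" by simp
  let ?f = "heat C f" and ?h = "heat C h"
  let ?df = "\<lambda>x. f x - heat C f x" and ?dh = "\<lambda>x. h x - heat C h x"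
  have tU: "touch C U \<subseteq> V" using Cons.prems bd_subset[of C] by (auto simp: touch_def)
  show ?case
  proof (cases "U \<inter> C = {}")
    case True
    then have "depends (V - C) h" using Cons.prems by (elim depends_mono) auto
    then have fixed: "\<And>x. x \<in> \<Omega> \<Longrightarrow> ?h x = h x" using heat_fixed[OF C] by blast
    have "ip f h = ip ?f h" using ip_heat[OF C \<open>depends (V - C) h\<close>] by simp
    then show ?thesis
      using Cons.IH[of U h ?f] Cons.prems True by (simp add: touch_def)
  next
    case False
    have "depends (touch C U) ?h"
      by (rule depends_mono[OF heat_depends[OF C Cons.prems(2)]]) (use False in \<open>auto simp: touch_def\<close>)
    then have IH: "(ip ?f ?h)\<^sup>2 \<le> leak Cs (touch C U) ?f * sqn ?h"
      using Cons.IH tU Cons.prems by auto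
    have CS: "(ip ?df ?dh)\<^sup>2 \<le> sqn ?df * sqn ?dh" by (rule Cauchy_Schwarz)
    let ?a = "leak Cs (touch C U) ?f" and ?b = "sqn ?h" and ?c = "sqn ?df" and ?d = "sqn ?dh"
    \<comment> \<open>Cauchy-Schwarz in the plane. It merges the two bounds in such a way that the
      squared norms of \<open>?h\<close> and \<open>?dh\<close> add up to that of
      \<open>h\<close>.\<close>
    have CS2: "(p * q + r * s)\<^sup>2 \<le> (p\<^sup>2 + r\<^sup>2) * (q\<^sup>2 + s\<^sup>2)" for p q r s :: real
      using zero_le_power2[of "p * s - r * q"] by (simp add: power2_eq_square algebra_simps)
    have nn: "?a \<ge> 0" "?b \<ge> 0" "?c \<ge> 0" "?d \<ge> 0" by (simp_all add: leak_nonneg sqn_nonneg)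
    have "\<bar>ip f h\<bar> \<le> \<bar>ip ?f ?h\<bar> + \<bar>ip ?df ?dh\<bar>" using ip_split[OF C, of f h] by linarith
    also have "\<dots> \<le> sqrt (?a * ?b) + sqrt (?c * ?d)"
      using IH CS by (intro add_mono) (auto intro!: real_le_rsqrt simp: power2_abs)
    finally have "\<bar>ip f h\<bar> \<le> sqrt (?a * ?b) + sqrt (?c * ?d)" .
    from power_mono[OF this abs_ge_zero, of 2]
    have "(ip f h)\<^sup>2 \<le> (sqrt (?a * ?b) + sqrt (?c * ?d))\<^sup>2" by simp
    also have "\<dots> = (sqrt ?a * sqrt ?b + sqrt ?c * sqrt ?d)\<^sup>2" by (simp add: real_sqrt_mult)
    also have "\<dots> \<le> ((sqrt ?a)\<^sup>2 + (sqrt ?c)\<^sup>2) * ((sqrt ?b)\<^sup>2 + (sqrt ?d)\<^sup>2)"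
      by (rule CS2)
    also have "\<dots> = (?c + ?a) * sqn h"
      using nn ip_split[OF C, of h h] by (simp add: algebra_simps)
    finally show ?thesis using False by simp
  qed
qed

text \<open>Each increment is charged with probability at most \<open>p\<close>, and by Pythagoras
  the squared increments telescope to the loss of squared norm.\<close>

lemma expectation_leak_le:
  fixes \<U> :: "'v set pmf"
  assumes "\<forall>C\<in>set Cs. C \<subseteq> V" "set_pmf \<U> \<subseteq> Pow V"
    and "\<And>pre C post. Cs = pre @ C # post \<Longrightarrow> measure_pmf.prob \<U> {U. fold touch pre U \<inter> C \<noteq> {}} \<le> p"
  shows "measure_pmf.expectation \<U> (\<lambda>U. leak Cs U f) \<le> p * (sqn f - sqn (fold heat Cs f)) + sqn (fold heat Cs f)"
  using assms
proof (induction Cs arbitrary: \<U> f)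
  case Nil
  then show ?case by simp
next
  case (Cons C Cs)
  have C: "C \<subseteq> V" using Cons.prems by simp
  have fin: "finite (set_pmf \<U>)" using Cons.prems(2) finite_V by (meson finite_Pow_iff finite_subset)
  have int: "integrable (measure_pmf \<U>) h" for h :: "'v set \<Rightarrow> real"
    using fin by (rule integrable_measure_pmf_finite)
  \<comment> \<open>Pushing the law forward by \<open>touch C\<close> absorbs the first block, which
    turns the hypothesis on prefixes into the one for the tail.\<close>
  define \<U>' where "\<U>' = map_pmf (touch C) \<U>"
  let ?f = "heat C f"
  have IH: "measure_pmf.expectation \<U>' (\<lambda>U. leak Cs U ?f)
      \<le> p * (sqn ?f - sqn (fold heat Cs ?f)) + sqn (fold heat Cs ?f)"
  proof (rule Cons.IH)
    show "\<forall>C\<in>set Cs. C \<subseteq> V" using Cons.prems by simp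
    show "set_pmf \<U>' \<subseteq> Pow V"
      using Cons.prems(2) bd_subset[of C] by (auto simp: \<U>'_def touch_def split: if_splits)
    fix pre C' post assume "Cs = pre @ C' # post"
    then show "measure_pmf.prob \<U>' {U. fold touch pre U \<inter> C' \<noteq> {}} \<le> p"
      using Cons.prems(3)[of "C # pre" C' post] by (simp add: \<U>'_def vimage_def)
  qed
  have "measure_pmf.expectation \<U> (\<lambda>U. if U \<inter> C = {} then 0 else sqn (\<lambda>x. f x - ?f x))
      = measure_pmf.expectation \<U> (\<lambda>U. indicator {U. U \<inter> C \<noteq> {}} U * sqn (\<lambda>x. f x - ?f x))"
    by (intro Bochner_Integration.integral_cong) auto
  also have "\<dots> = measure_pmf.prob \<U> {U. U \<inter> C \<noteq> {}} * sqn (\<lambda>x. f x - ?f x)"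
    by simp
  also have "\<dots> \<le> p * sqn (\<lambda>x. f x - ?f x)"
    using Cons.prems(3)[of "[]" C Cs] by (intro mult_right_mono sqn_nonneg) simp
  finally have "measure_pmf.expectation \<U> (\<lambda>U. leak (C # Cs) U f)
      \<le> p * sqn (\<lambda>x. f x - ?f x) + measure_pmf.expectation \<U>' (\<lambda>U. leak Cs U ?f)"
    by (simp add: int \<U>'_def del: if_split)
  also have "\<dots> \<le> p * sqn (\<lambda>x. f x - ?f x) + (p * (sqn ?f - sqn (fold heat Cs ?f)) + sqn (fold heat Cs ?f))"
    using IH by simp
  also have "sqn (\<lambda>x. f x - ?f x) = sqn f - sqn ?f" using ip_split[OF C, of f f] by simp
  finally show ?case by (simp add: algebra_simps)
qed

end

section \<open>Oscillations\<close>

context spin_system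
begin

text \<open>A common bound at all sites is a Lipschitz constant for the Hamming distance. All of
  \<open>\<Omega>\<close> is used, so that single-site changes connect any two
  configurations.\<close>

definition osc_le :: "(('v \<Rightarrow> 's) \<Rightarrow> real) \<Rightarrow> 'v \<Rightarrow> real \<Rightarrow> bool" where
  "osc_le f u c \<longleftrightarrow> (\<forall>x\<in>\<Omega>. \<forall>y\<in>\<Omega>. (\<forall>v. v \<noteq> u \<longrightarrow> x v = y v) \<longrightarrow> \<bar>f x - f y\<bar> \<le> c)"

text \<open>\<open>influence_le C u \<theta>\<close>: changing the boundary condition at \<open>u\<close> costs at most the expected Hamming
  distance \<open>\<theta>\<close> inside \<open>C\<close>, in the dual formulation by Lipschitz functions.\<close>

definition influence_le :: "'v set \<Rightarrow> 'v \<Rightarrow> real \<Rightarrow> bool" where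
  "influence_le C u \<theta> \<longleftrightarrow> (\<forall>f D c. D \<ge> 0 \<longrightarrow> (\<forall>v\<in>C. osc_le f v D) \<longrightarrow> osc_le f u c \<longrightarrow>
     osc_le (heat C f) u (c + \<theta> * D))"

lemma osc_leD:
  "osc_le f u c \<Longrightarrow> x \<in> \<Omega> \<Longrightarrow> y \<in> \<Omega> \<Longrightarrow> (\<And>v. v \<noteq> u \<Longrightarrow> x v = y v) \<Longrightarrow> \<bar>f x - f y\<bar> \<le> c"
  unfolding osc_le_def by blast

lemma osc_leI:
  "(\<And>x y. x \<in> \<Omega> \<Longrightarrow> y \<in> \<Omega> \<Longrightarrow> (\<And>v. v \<noteq> u \<Longrightarrow> x v = y v) \<Longrightarrow> \<bar>f x - f y\<bar> \<le> c) \<Longrightarrow> osc_le f u c"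
  unfolding osc_le_def by blast

lemma osc_le_mono: "osc_le f u c \<Longrightarrow> c \<le> c' \<Longrightarrow> osc_le f u c'"
  unfolding osc_le_def by fastforce

lemma osc_le_outside:
  assumes "u \<notin> V" "0 \<le> c"
  shows "osc_le f u c"
proof (rule osc_leI)
  fix x y assume xy: "x \<in> \<Omega>" "y \<in> \<Omega>" "\<And>v. v \<noteq> u \<Longrightarrow> x v = y v"
  have "x = y"
  proof (rule PiE_ext[OF xy(1,2)])
    fix v assume "v \<in> V"
    then show "x v = y v" using xy(3)[of v] assms by blast
  qed
  then show "\<bar>f x - f y\<bar> \<le> c" using assms by simp
qed

lemma fun_upd_in:
  assumes "x \<in> \<Omega>" "y \<in> \<Omega>"
  shows "x(u := y u) \<in> \<Omega>"
proof (cases "u \<in> V")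
  case True
  then show ?thesis using assms by (auto simp: PiE_iff extensional_def)
next
  case False
  then have "x u = y u" using assms by (simp add: PiE_iff extensional_def)
  then have "x(u := y u) = x" by (metis fun_upd_triv)
  with assms(1) show ?thesis by metis
qed

text \<open>The coordinates in \<open>A\<close> are changed one at a time; the intermediate
  configurations stay in the product set \<open>\<Omega>\<close>.\<close>

lemma osc_path:
  assumes "finite A" "x \<in> \<Omega>" "y \<in> \<Omega>" "\<And>v. v \<notin> A \<Longrightarrow> x v = y v" "\<And>u. u \<in> A \<Longrightarrow> osc_le f u D"
  shows "\<bar>f x - f y\<bar> \<le> real (card A) * D"
  using assms
proof (induction A arbitrary: x rule: finite_induct)
  case empty
  then have "x = y" by auto
  then show ?case by simp
next
  case (insert u A)
  let ?z = "x(u := y u)"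
  have z: "?z \<in> \<Omega>" using insert.prems by (intro fun_upd_in)
  have "\<bar>f x - f ?z\<bar> \<le> D"
    by (rule osc_leD[OF insert.prems(4)[of u] insert.prems(1) z]) simp_all
  moreover have "\<bar>f ?z - f y\<bar> \<le> real (card A) * D"
  proof (rule insert.IH[OF z insert.prems(2)])
    fix v assume "v \<notin> A"
    then show "?z v = y v" using insert.prems(3)[of v] by simp
  qed (use insert.prems(4) in blast)
  ultimately show ?case using insert.hyps by (simp add: algebra_simps)
qed

lemma osc_heat_inside:
  assumes C: "C \<subseteq> V" and u: "u \<in> C"
  shows "osc_le (heat C f) u 0"
proof (rule osc_leI)
  fix x y assume "x \<in> \<Omega>" "y \<in> \<Omega>" and eq: "\<And>v. v \<noteq> u \<Longrightarrow> x v = y v"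
  then have "heat C f x = heat C f y"
    by (rule dependsD[OF heat_depends_compl[OF C]]) (use u eq in blast)
  then show "\<bar>heat C f x - heat C f y\<bar> \<le> 0" by simp
qed

lemma osc_heat_outside:
  assumes C: "C \<subseteq> V" and u: "u \<notin> C \<union> bd C" and f: "osc_le f u c"
  shows "osc_le (heat C f) u c"
proof (rule osc_leI)
  fix x y assume xy: "x \<in> \<Omega>" "y \<in> \<Omega>" and eq: "\<And>v. v \<noteq> u \<Longrightarrow> x v = y v"
  have r: "restrict x (bd C) = restrict y (bd C)"
  proof (rule restrict_ext)
    fix v assume "v \<in> bd C"
    then show "x v = y v" using eq[of v] u by blast
  qed
  show "\<bar>heat C f x - heat C f y\<bar> \<le> c"
    unfolding heat_def r
  proof (rule expectation_diff_le[OF finite_set_\<kappa>[OF C xy(2)]])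
    fix \<eta> assume \<eta>: "\<eta> \<in> set_pmf (\<kappa> C (restrict y (bd C)))"
    show "\<bar>f (override_on x \<eta> C) - f (override_on y \<eta> C)\<bar> \<le> c"
    proof (rule osc_leD[OF f])
      show "override_on x \<eta> C \<in> \<Omega>" "override_on y \<eta> C \<in> \<Omega>"
        using override_\<kappa>_in[OF C xy(1)] override_\<kappa>_in[OF C xy(2)] \<eta> r by simp_all
      show "override_on x \<eta> C v = override_on y \<eta> C v" if "v \<noteq> u" for v
        using eq[OF that] by (simp add: override_on_def)
    qed
  qed
qed

text \<open>No coupling is needed: the far part \<open>B\<close> of \<open>C\<close> is controlled by total variation as a whole,
  and the part near \<open>u\<close> by its cardinality.\<close>

lemma influence_le_total_variation:
  assumes C: "C \<subseteq> V" and u: "u \<in> bd C" and B: "B \<subseteq> C" and near: "real (card (C - B)) \<le> k"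
    and tv: "\<And>\<psi> \<psi>'. B \<noteq> {} \<Longrightarrow> \<psi> \<in> bd C \<rightarrow>\<^sub>E S \<Longrightarrow> \<psi>' \<in> bd C \<rightarrow>\<^sub>E S \<Longrightarrow> \<forall>v\<in>bd C - {u}. \<psi> v = \<psi>' v \<Longrightarrow>
       total_variation (marginal B (\<kappa> C \<psi>)) (marginal B (\<kappa> C \<psi>')) \<le> \<tau>"
  shows "influence_le C u (2 * k + real (card B) * \<tau>)"
  unfolding influence_le_def
proof (intro allI impI, rule osc_leI)
  fix f D c x y
  assume D: "D \<ge> 0" and fC: "\<forall>v\<in>C. osc_le f v D" and fu: "osc_le f u c"
    and xy: "x \<in> \<Omega>" "y \<in> \<Omega>" and eq: "\<And>v. v \<noteq> u \<Longrightarrow> x v = y v"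
  let ?p = "\<kappa> C (restrict x (bd C))" and ?q = "\<kappa> C (restrict y (bd C))"
  have fin: "finite (set_pmf ?p)" "finite (set_pmf ?q)" using finite_set_\<kappa>[OF C] xy by auto
  have finC: "finite C" using C finite_V by (rule finite_subset)
  have uC: "u \<notin> C" using u bd_subset[of C] by blast
  let ?\<phi> = "\<lambda>\<eta>. f (override_on x \<eta> C)" and ?\<psi> = "\<lambda>\<xi>. f (override_on x \<xi> B)"
  have sup: "\<eta> \<in> C \<rightarrow>\<^sub>E S" if "\<eta> \<in> set_pmf ?p \<union> set_pmf ?q" for \<eta>
    using set_\<kappa>[OF C xy(1)] set_\<kappa>[OF C xy(2)] that by (elim UnE) (auto dest: subsetD)
  have BV: "B \<subseteq> V" using B C by (rule subset_trans)
  have inB: "override_on x \<eta> B \<in> \<Omega>" if "\<eta> \<in> C \<rightarrow>\<^sub>E S" for \<eta>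
    using that xy(1) B C by (auto simp: override_on_def PiE_iff extensional_def)
  \<comment> \<open>Resampling on \<open>B\<close> alone instead of \<open>C\<close> alters the
    argument of \<open>f\<close> at no more than \<open>k\<close> sites. This is used for both laws,
    whence \<open>2 * k\<close>.\<close>
  have near_diff: "\<bar>measure_pmf.expectation r ?\<phi> - measure_pmf.expectation (marginal B r) ?\<psi>\<bar> \<le> k * D"
    if r: "set_pmf r \<subseteq> C \<rightarrow>\<^sub>E S" and finr: "finite (set_pmf r)" for r
  proof -
    have "\<bar>measure_pmf.expectation r ?\<phi> - measure_pmf.expectation r (\<lambda>\<eta>. f (override_on x \<eta> B))\<bar> \<le> k * D"
    proof (rule expectation_diff_le[OF finr])
      fix \<eta> assume "\<eta> \<in> set_pmf r"
      then have \<eta>: "\<eta> \<in> C \<rightarrow>\<^sub>E S" using r by (rule rev_subsetD)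
      have "\<bar>f (override_on x \<eta> C) - f (override_on x \<eta> B)\<bar> \<le> real (card (C - B)) * D"
        by (rule osc_path[OF _ override_in[OF C xy(1) \<eta>] inB[OF \<eta>]])
          (use finC fC B in \<open>auto simp: override_on_def\<close>)
      also have "\<dots> \<le> k * D" using near D by (rule mult_right_mono)
      finally show "\<bar>f (override_on x \<eta> C) - f (override_on x \<eta> B)\<bar> \<le> k * D" .
    qed
    moreover have "override_on x (restrict \<eta> B) B = override_on x \<eta> B" for \<eta>
      by (auto simp: override_on_def)
    ultimately show ?thesis by (simp add: marginal_def)
  qed
  have far: "\<bar>measure_pmf.expectation (marginal B ?p) ?\<psi> - measure_pmf.expectation (marginal B ?q) ?\<psi>\<bar>
      \<le> real (card B) * \<tau> * D"
  proof -
    have "\<bar>measure_pmf.expectation (marginal B ?p) ?\<psi> - measure_pmf.expectation (marginal B ?q) ?\<psi>\<bar>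
        \<le> (real (card B) * D) * total_variation (marginal B ?p) (marginal B ?q)"
    proof (rule expectation_diff_le_total_variation)
      fix \<xi> \<xi>' assume "\<xi> \<in> set_pmf (marginal B ?p) \<union> set_pmf (marginal B ?q)"
        "\<xi>' \<in> set_pmf (marginal B ?p) \<union> set_pmf (marginal B ?q)"
      then obtain \<eta> \<eta>' where \<eta>: "\<eta> \<in> set_pmf ?p \<union> set_pmf ?q" "\<xi> = restrict \<eta> B"
        "\<eta>' \<in> set_pmf ?p \<union> set_pmf ?q" "\<xi>' = restrict \<eta>' B"
        unfolding marginal_def set_map_pmf by blast
      have "\<bar>f (override_on x \<eta> B) - f (override_on x \<eta>' B)\<bar> \<le> real (card B) * D"
        by (rule osc_path[OF finite_subset[OF B finC] inB[OF sup[OF \<eta>(1)]] inB[OF sup[OF \<eta>(3)]]])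
          (use fC B in \<open>auto simp: override_on_def\<close>)
      moreover have "override_on x (restrict \<eta> B) B = override_on x \<eta> B" for \<eta>
        by (auto simp: override_on_def)
      ultimately show "\<bar>?\<psi> \<xi> - ?\<psi> \<xi>'\<bar> \<le> real (card B) * D"
        using \<eta> by simp
    qed (use fin in \<open>auto simp: marginal_def\<close>)
    also have "\<dots> \<le> real (card B) * \<tau> * D"
    proof (cases "B = {}")
      case False
      have "total_variation (marginal B ?p) (marginal B ?q) \<le> \<tau>"
        by (rule tv[OF False]) (use restrict_bd xy eq in auto)
      then have "(real (card B) * D) * total_variation (marginal B ?p) (marginal B ?q) \<le> (real (card B) * D) * \<tau>"
        by (rule mult_left_mono) (use D in simp)
      then show ?thesis by (simp add: mult_ac)
    qed simp
    finally show ?thesis .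
  qed
  \<comment> \<open>With equal laws inside \<open>C\<close>, only the disagreement at
    \<open>u\<close> itself is left.\<close>
  have same: "\<bar>measure_pmf.expectation ?q (\<lambda>\<eta>. f (override_on x \<eta> C)) - heat C f y\<bar> \<le> c"
    unfolding heat_def
  proof (rule expectation_diff_le[OF fin(2)])
    fix \<eta> assume "\<eta> \<in> set_pmf ?q"
    then have \<eta>: "\<eta> \<in> C \<rightarrow>\<^sub>E S" using sup by blast
    show "\<bar>f (override_on x \<eta> C) - f (override_on y \<eta> C)\<bar> \<le> c"
      by (rule osc_leD[OF fu override_in[OF C xy(1) \<eta>] override_in[OF C xy(2) \<eta>]])
        (use eq in \<open>simp add: override_on_def\<close>)
  qed
  have "heat C f x = measure_pmf.expectation ?p ?\<phi>" by (simp add: heat_def)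
  with near_diff[OF set_\<kappa>[OF C xy(1)] fin(1)] near_diff[OF set_\<kappa>[OF C xy(2)] fin(2)] far same
  show "\<bar>heat C f x - heat C f y\<bar> \<le> c + (2 * k + real (card B) * \<tau>) * D"
    unfolding distrib_right by linarith
qed

text \<open>A site inside a block loses its oscillation and, by separation, lies on no block
  boundary, so it never regains it. A boundary site pays \<open>\<theta> * D\<close> per visit,
  because separation also keeps the oscillation inside the current block at most
  \<open>D\<close>.\<close>

lemma osc_round:
  assumes sub: "\<And>C. C \<in> \<D> \<Longrightarrow> C \<subseteq> V"
    and sep: "\<And>C C'. C \<in> \<D> \<Longrightarrow> C' \<in> \<D> \<Longrightarrow> C \<inter> bd C' = {}"
    and infl: "\<And>C u. C \<in> \<D> \<Longrightarrow> u \<in> bd C \<Longrightarrow> influence_le C u \<theta>"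
    and D: "D \<ge> 0" and f: "\<And>u. osc_le f u D" and Cs: "set Cs \<subseteq> \<D>"
  shows "osc_le (fold heat Cs f) u
    (if u \<in> \<Union>(set Cs) then 0 else D * (1 + \<theta> * real (length (filter (\<lambda>C. u \<in> bd C) Cs))))"
  using Cs
proof (induction Cs arbitrary: u rule: rev_induct)
  case Nil
  then show ?case using f by simp
next
  case (snoc C Cs)
  let ?g = "fold heat Cs f"
  have C: "C \<in> \<D>" "C \<subseteq> V" and sub': "set Cs \<subseteq> \<D>" using snoc.prems sub by auto
  note IH = snoc.IH[OF sub']
  consider "u \<in> C" | "u \<notin> C" "u \<in> bd C" | "u \<notin> C \<union> bd C" by blast
  then show ?case
  proof cases
    case 1
    then show ?thesis using osc_heat_inside[OF C(2), of u ?g] by simp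
  next
    case 2
    have notin: "u \<notin> \<Union>(set Cs)" using 2 sep[OF _ C(1)] sub' by blast
    have "osc_le ?g v D" if "v \<in> C" for v
    proof -
      have "filter (\<lambda>C. v \<in> bd C) Cs = []"
        using sep[OF C(1)] that sub' by (auto simp: filter_empty_conv)
      then show ?thesis using IH[of v] D by (auto split: if_splits intro: osc_le_mono)
    qed
    then have "osc_le (heat C ?g) u
        (D * (1 + \<theta> * real (length (filter (\<lambda>C. u \<in> bd C) Cs))) + \<theta> * D)"
      using infl[OF C(1) 2(2)] D IH[of u] notin unfolding influence_le_def by simp
    then show ?thesis using 2 notin by (simp add: algebra_simps)
  next
    case 3
    then show ?thesis using osc_heat_outside[OF C(2) 3 IH[of u]] by (cases "u \<in> \<Union>(set Cs)") simp_all
  qed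
qed

end

section \<open>Contraction by rounds of separated blocks\<close>

lemma card_Image_relpow_le:
  assumes nb: "nb \<subseteq> V \<times> V" and finV: "finite V" and fin: "finite A" "A \<subseteq> V"
    and deg: "\<And>v. v \<in> V \<Longrightarrow> card (nb\<inverse> `` {v}) \<le> m"
  shows "card ((nb ^^ k)\<inverse> `` A) \<le> card A * m ^ k"
  using fin
proof (induction k arbitrary: A)
  case 0
  then show ?case by simp
next
  case (Suc k)
  have sub: "nb\<inverse> `` A \<subseteq> V" using nb by auto
  have "card (nb\<inverse> `` A) = card (\<Union>v\<in>A. nb\<inverse> `` {v})" by (intro arg_cong[where f=card]) auto
  also have "\<dots> \<le> (\<Sum>v\<in>A. card (nb\<inverse> `` {v}))" using Suc.prems by (intro card_UN_le) simp
  also have "\<dots> \<le> card A * m" using sum_bounded_above[of A "\<lambda>v. card (nb\<inverse> `` {v})" m] deg Suc.prems by auto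
  finally have step: "card (nb\<inverse> `` A) * m ^ k \<le> card A * m * m ^ k" by (rule mult_right_mono) simp
  have "(nb ^^ Suc k)\<inverse> `` A = (nb ^^ k)\<inverse> `` (nb\<inverse> `` A)" by (auto simp: relcomp_unfold)
  then have "card ((nb ^^ Suc k)\<inverse> `` A) \<le> card (nb\<inverse> `` A) * m ^ k"
    using Suc.IH[OF finite_subset[OF sub finV] sub] by simp
  also note step
  finally show ?case by (simp add: mult.assoc)
qed

text \<open>A round is drawn uniformly from \<open>I\<close>; \<open>\<alpha>\<close> and
  \<open>\<beta>\<close> bound the chances that a vertex lies inside a block (from below) and on a
  block boundary (from above). The factor 2 in the rate accounts for running a round forwards and
  backwards. The relation \<open>nb\<close> bounds how far one round spreads a dependence
  set.\<close>

locale block_rounds = spin_system V E S \<mu> \<kappa>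
  for V :: "'v set" and E S and \<mu> :: "('v \<Rightarrow> 's) pmf" and \<kappa> +
  fixes I :: "'i set" and R :: "'i \<Rightarrow> 'v set list" and \<theta> \<alpha> \<beta> \<rho> :: real
    and nb :: "('v \<times> 'v) set" and m :: nat
  assumes I: "finite I" "I \<noteq> {}"
    and block_subset: "\<And>s C. s \<in> I \<Longrightarrow> C \<in> set (R s) \<Longrightarrow> C \<subseteq> V"
    and block_sep: "\<And>s C C'. s \<in> I \<Longrightarrow> C \<in> set (R s) \<Longrightarrow> C' \<in> set (R s) \<Longrightarrow> C \<inter> ext_boundary E C' = {}"
    and block_infl: "\<And>s C u. s \<in> I \<Longrightarrow> C \<in> set (R s) \<Longrightarrow> u \<in> ext_boundary E C \<Longrightarrow> influence_le C u \<theta>"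
    and bd_once: "\<And>s u. s \<in> I \<Longrightarrow> length (filter (\<lambda>C. u \<in> ext_boundary E C) (R s)) \<le> 1"
    and cover: "\<And>u. u \<in> V \<Longrightarrow> \<alpha> * card I \<le> card {s \<in> I. u \<in> \<Union>(set (R s))}"
    and bdry: "\<And>u. u \<in> V \<Longrightarrow> card {s \<in> I. \<exists>C\<in>set (R s). u \<in> ext_boundary E C} \<le> \<beta> * card I"
    and \<theta>: "\<theta> \<ge> 0" and \<rho>: "\<rho> > 0" "1 - \<alpha> + 2 * \<theta> * \<beta> \<le> \<rho>"
    and nb: "nb \<subseteq> V \<times> V" "Id_on V \<subseteq> nb"
    and nb_block: "\<And>s C w v. s \<in> I \<Longrightarrow> C \<in> set (R s) \<Longrightarrow> w \<in> C \<Longrightarrow> v \<in> ext_boundary E C \<Longrightarrow> (w, v) \<in> nb"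
    and nb_deg: "\<And>v. v \<in> V \<Longrightarrow> card (nb\<inverse> `` {v}) \<le> m"
    and block_card: "\<And>s C. s \<in> I \<Longrightarrow> C \<in> set (R s) \<Longrightarrow> card C \<le> m"
begin

text \<open>The mean of A* A over the round operators A, hence self-adjoint, with quadratic form the
  mean squared norm after a round.\<close>

definition avg :: "(('v \<Rightarrow> 's) \<Rightarrow> real) \<Rightarrow> ('v \<Rightarrow> 's) \<Rightarrow> real" where
  "avg f x = (1 / card I) * (\<Sum>s\<in>I. fold heat (R s @ rev (R s)) f x)"

lemma card_I: "real (card I) > 0" using I by (simp add: card_gt_0_iff)

lemma ip_avg: "ip (avg f) g = (1 / card I) * (\<Sum>s\<in>I. ip (fold heat (R s) f) (fold heat (R s) g))"
proof -
  have "ip (fold heat (R s @ rev (R s)) f) g = ip (fold heat (R s) f) (fold heat (R s) g)" if "s \<in> I" for s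
    using fold_heat_adjoint[of "rev (R s)" "fold heat (R s) f" g] block_subset[OF that] by simp
  then show ?thesis unfolding avg_def[abs_def] ip_cmult_left ip_sum_left by simp
qed

lemma avg_selfadjoint: "ip (avg f) g = ip f (avg g)"
  using ip_avg[of f g] ip_avg[of g f] by (simp add: ip_commute)

lemma expectation_avg: "measure_pmf.expectation \<mu> (avg f) = measure_pmf.expectation \<mu> f"
proof -
  have "measure_pmf.expectation \<mu> (avg f)
      = (1 / card I) * (\<Sum>s\<in>I. measure_pmf.expectation \<mu> (fold heat (R s @ rev (R s)) f))"
    unfolding avg_def[abs_def] by simp
  also have "\<dots> = (1 / card I) * (\<Sum>s\<in>I. measure_pmf.expectation \<mu> f)"
    by (intro arg_cong2[where f="(*)"] refl sum.cong expectation_fold_heat) (auto dest: block_subset)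
  finally show ?thesis using card_I by simp
qed

text \<open>Path coupling: in the bound for a symmetrised round the oscillation at \<open>u\<close>
  vanishes if \<open>u\<close> is inside a block, grows by at most \<open>2 * \<theta> * D\<close>
  if \<open>u\<close> is on a boundary, and is at most \<open>D\<close> otherwise. Averaging gives
  the factor \<open>1 - \<alpha> + 2 * \<theta> * \<beta>\<close>.\<close>

lemma osc_avg:
  assumes D: "D \<ge> 0" and f: "\<And>u. osc_le f u D"
  shows "osc_le (avg f) u (\<rho> * D)"
proof (cases "u \<in> V")
  case False
  then show ?thesis using D \<rho> by (intro osc_le_outside) auto
next
  case True
  define c where "c = (\<lambda>s. D * (1 - indicator {s \<in> I. u \<in> \<Union>(set (R s))} s
    + 2 * \<theta> * indicator {s \<in> I. \<exists>C\<in>set (R s). u \<in> bd C} s))"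
  have round: "osc_le (fold heat (R s @ rev (R s)) f) u (c s)" if s: "s \<in> I" for s
  proof (rule osc_le_mono)
    show "osc_le (fold heat (R s @ rev (R s)) f) u
      (if u \<in> \<Union>(set (R s @ rev (R s))) then 0
       else D * (1 + \<theta> * real (length (filter (\<lambda>C. u \<in> bd C) (R s @ rev (R s))))))"
      by (rule osc_round[where \<D>="set (R s)"])
        (use block_subset[OF s] block_sep[OF s] block_infl[OF s] D f in auto)
    have len: "length (filter (\<lambda>C. u \<in> bd C) (rev (R s))) = length (filter (\<lambda>C. u \<in> bd C) (R s))"
      by (simp flip: rev_filter)
    show "(if u \<in> \<Union>(set (R s @ rev (R s))) then 0
       else D * (1 + \<theta> * real (length (filter (\<lambda>C. u \<in> bd C) (R s @ rev (R s)))))) \<le> c s"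
    proof (cases "\<exists>C\<in>set (R s). u \<in> bd C")
      case bd: True
      have "\<theta> * real (length (filter (\<lambda>C. u \<in> bd C) (R s))) \<le> \<theta> * 1"
        using bd_once[OF s, of u] \<theta> by (intro mult_left_mono) auto
      then have "D * (1 + \<theta> * (real (length (filter (\<lambda>C. u \<in> bd C) (R s))) + real (length (filter (\<lambda>C. u \<in> bd C) (R s))))) \<le> D * (1 + 2 * \<theta>)"
        using D by (intro mult_left_mono) (auto simp: distrib_left)
      then show ?thesis using bd s D \<theta> by (simp add: c_def len indicator_def)
    next
      case False
      then have "filter (\<lambda>C. u \<in> bd C) (R s) = []" by (auto simp: filter_empty_conv)
      then show ?thesis using False s D by (simp add: c_def len indicator_def)
    qed
  qed
  have "osc_le (avg f) u ((1 / card I) * (\<Sum>s\<in>I. c s))"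
  proof (rule osc_leI)
    fix x y assume xy: "x \<in> \<Omega>" "y \<in> \<Omega>" "\<And>v. v \<noteq> u \<Longrightarrow> x v = y v"
    have "\<bar>avg f x - avg f y\<bar> = (1 / card I) *
        \<bar>\<Sum>s\<in>I. fold heat (R s @ rev (R s)) f x - fold heat (R s @ rev (R s)) f y\<bar>"
      unfolding avg_def sum_subtractf right_diff_distrib[symmetric] abs_mult using card_I by simp
    also have "\<dots> \<le> (1 / card I) * (\<Sum>s\<in>I. c s)"
      by (intro mult_left_mono order_trans[OF sum_abs] sum_mono osc_leD[OF round] xy) auto
    finally show "\<bar>avg f x - avg f y\<bar> \<le> (1 / card I) * (\<Sum>s\<in>I. c s)" .
  qed
  moreover have "(1 / card I) * (\<Sum>s\<in>I. c s) \<le> \<rho> * D"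
  proof -
    let ?a = "real (card {s \<in> I. u \<in> \<Union>(set (R s))})"
    let ?b = "real (card {s \<in> I. \<exists>C\<in>set (R s). u \<in> bd C})"
    have "(\<Sum>s\<in>I. c s) = D * (card I - ?a + 2 * \<theta> * ?b)"
      unfolding c_def sum_distrib_left[symmetric] sum.distrib sum_subtractf
      using I by (simp add: sum.If_cases indicator_def Int_def conj_commute cong: conj_cong)
    also have "\<dots> \<le> D * (\<rho> * card I)"
    proof (rule mult_left_mono[OF _ D])
      have "2 * \<theta> * ?b \<le> 2 * \<theta> * (\<beta> * card I)" using bdry[OF True] \<theta> by (intro mult_left_mono) auto
      moreover have "(1 - \<alpha> + 2 * \<theta> * \<beta>) * card I \<le> \<rho> * card I" using \<rho> by (intro mult_right_mono) auto
      ultimately show "card I - ?a + 2 * \<theta> * ?b \<le> \<rho> * card I"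
        using cover[OF True] by (simp add: algebra_simps)
    qed
    finally show ?thesis using card_I by (simp add: field_simps)
  qed
  ultimately show ?thesis by (rule osc_le_mono)
qed

text \<open>A mean-zero function is bounded by \<open>card V\<close> times its single-site
  oscillation, which shrinks by \<open>\<rho>\<close> at each application. The constant
  \<open>K\<close> may depend on \<open>f\<close> and \<open>V\<close>, as \<open>sqn_avg_le\<close>
  removes it.\<close>

lemma sqn_avg_power_le:
  assumes mean: "measure_pmf.expectation \<mu> f = 0"
  obtains K where "\<And>k. sqn ((avg ^^ k) f) \<le> K * (\<rho>\<^sup>2) ^ k"
proof -
  define D where "D = 2 * Max ((\<lambda>x. \<bar>f x\<bar>) ` \<Omega>)"
  have ne: "\<Omega> \<noteq> {}" using supp set_pmf_not_empty[of \<mu>] by auto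
  have le: "\<bar>f x\<bar> \<le> D / 2" if "x \<in> \<Omega>" for x
    unfolding D_def using that finite_\<Omega> by simp
  have D: "D \<ge> 0"
  proof -
    obtain x where "x \<in> \<Omega>" using ne by blast
    from le[OF this] show ?thesis by linarith
  qed
  have fD: "osc_le f u D" for u
  proof (rule osc_leI)
    fix x y assume "x \<in> \<Omega>" "y \<in> \<Omega>"
    then show "\<bar>f x - f y\<bar> \<le> D" using le[of x] le[of y] by linarith
  qed
  have osc: "osc_le ((avg ^^ k) f) u (\<rho> ^ k * D)" for k u
  proof (induction k arbitrary: u)
    case (Suc k)
    then show ?case using osc_avg[of "\<rho> ^ k * D" "(avg ^^ k) f" u] D \<rho> by (simp add: mult.assoc)
  qed (use fD in simp)
  have mean': "measure_pmf.expectation \<mu> ((avg ^^ k) f) = 0" for k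
    by (induction k) (simp_all add: mean expectation_avg)
  have "sqn ((avg ^^ k) f) \<le> (real (card V) * D)\<^sup>2 * (\<rho>\<^sup>2) ^ k" for k
  proof -
    let ?g = "(avg ^^ k) f" and ?B = "real (card V) * (\<rho> ^ k * D)"
    have bound: "\<bar>?g x\<bar> \<le> ?B" if x: "x \<in> \<Omega>" for x
    proof -
      have "\<bar>measure_pmf.expectation \<mu> ?g - measure_pmf.expectation \<mu> (\<lambda>_. ?g x)\<bar> \<le> ?B"
      proof (rule expectation_diff_le[OF finite_supp])
        fix y assume "y \<in> set_pmf \<mu>"
        then have y: "y \<in> \<Omega>" using supp by blast
        show "\<bar>?g y - ?g x\<bar> \<le> ?B"
          by (rule osc_path[OF finite_V y x _ osc]) (use x y in \<open>auto simp: PiE_iff extensional_def\<close>)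
      qed
      then show ?thesis by (simp add: mean')
    qed
    have "sqn ?g \<le> measure_pmf.expectation \<mu> (\<lambda>_. ?B\<^sup>2)"
      unfolding ip_def
    proof (rule expectation_mono_pmf[OF finite_supp])
      fix x assume "x \<in> set_pmf \<mu>"
      then have "\<bar>?g x\<bar> \<le> ?B" using supp bound by blast
      from power_mono[OF this abs_ge_zero, of 2] show "?g x * ?g x \<le> ?B\<^sup>2"
        by (simp add: power2_eq_square)
    qed
    also have "\<dots> = (real (card V) * D)\<^sup>2 * (\<rho>\<^sup>2) ^ k"
      by (simp add: power_mult_distrib power_mult[symmetric] mult.commute)
    finally show ?thesis .
  qed
  then show ?thesis using that by blast
qed

text \<open>Self-adjointness moves \<open>k\<close> factors across, giving
  \<open>sqn ((avg ^^ k) f) = ip f ((avg ^^ (2 * k)) f)\<close>; then Cauchy-Schwarz.\<close>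

lemma sqn_avg_power_sq_le: "(sqn ((avg ^^ k) f))\<^sup>2 \<le> sqn f * sqn ((avg ^^ (2 * k)) f)"
proof -
  have adj: "ip ((avg ^^ j) g) h = ip g ((avg ^^ j) h)" for j g h
  proof (induction j arbitrary: h)
    case (Suc j)
    then show ?case by (simp add: avg_selfadjoint funpow_swap1[of avg _ h])
  qed simp
  have "sqn ((avg ^^ k) f) = ip f ((avg ^^ (2 * k)) f)"
    by (simp add: adj mult_2 funpow_add)
  then show ?thesis using Cauchy_Schwarz by simp
qed

text \<open>A self-adjoint operator whose iterates decay like \<open>\<rho> ^ k\<close> on every vector, with a constant
  depending on the vector, has norm at most \<open>\<rho>\<close>.\<close>

lemma sqn_avg_le:
  assumes mean: "measure_pmf.expectation \<mu> f = 0"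
  shows "sqn (avg f) \<le> \<rho>\<^sup>2 * sqn f"
proof (rule ccontr)
  assume *: "\<not> ?thesis"
  obtain K where K: "\<And>k. sqn ((avg ^^ k) f) \<le> K * (\<rho>\<^sup>2) ^ k"
    using sqn_avg_power_le[OF mean] by blast
  have N1: "(sqn (avg f))\<^sup>2 \<le> sqn f * sqn ((avg ^^ 2) f)"
    using sqn_avg_power_sq_le[of 1 f] by simp
  have N0: "sqn f > 0"
  proof (rule ccontr)
    assume "\<not> sqn f > 0"
    then have "sqn f = 0" using sqn_nonneg[of f] by linarith
    then have "sqn (avg f) = 0" using N1 by simp
    with * \<open>sqn f = 0\<close> show False by simp
  qed
  \<comment> \<open>The ratio at the first step. Doubling the number of iterations at least squares
    the ratio, so at powers of two the squared norm is at least
    \<open>q ^ k * sqn f\<close>.\<close>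
  define q where "q = sqn (avg f) / sqn f"
  have q: "q > \<rho>\<^sup>2" using * N0 by (simp add: q_def field_simps)
  have q0: "q \<ge> 0" using q zero_le_power2[of \<rho>] by linarith
  have lower: "q ^ (2 ^ j) * sqn f \<le> sqn ((avg ^^ (2 ^ j)) f)" for j
  proof (induction j)
    case 0
    then show ?case using N0 by (simp add: q_def)
  next
    case (Suc j)
    have "(q ^ (2 ^ j) * sqn f)\<^sup>2 \<le> (sqn ((avg ^^ (2 ^ j)) f))\<^sup>2"
      using Suc.IH q0 N0 by (intro power_mono) auto
    also have "\<dots> \<le> sqn f * sqn ((avg ^^ (2 * 2 ^ j)) f)" by (rule sqn_avg_power_sq_le)
    finally have "sqn f * (q ^ (2 ^ Suc j) * sqn f) \<le> sqn f * sqn ((avg ^^ (2 ^ Suc j)) f)"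
      by (simp add: power_mult_distrib power2_eq_square power_add[symmetric] mult_2 mult_ac)
    then show ?case using N0 by simp
  qed
  \<comment> \<open>Against the decay rate \<open>\<rho>\<^sup>2\<close>, this lower bound would
    keep powers of \<open>r > 1\<close> bounded.\<close>
  define r where "r = q / \<rho>\<^sup>2"
  have r: "r > 1" using q \<rho> by (simp add: r_def)
  have "r ^ (2 ^ j) \<le> K / sqn f" for j
  proof -
    have "q ^ (2 ^ j) * sqn f \<le> K * (\<rho>\<^sup>2) ^ (2 ^ j)" using lower[of j] K[of "2 ^ j"] by linarith
    then show ?thesis using N0 \<rho> by (simp add: r_def power_divide field_simps)
  qed
  moreover obtain k where k: "K / sqn f < r ^ k" using real_arch_pow[OF r] by blast
  moreover have "r ^ k \<le> r ^ (2 ^ k)" using r by (intro power_increasing) auto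
  ultimately show False by (smt (verit))
qed

text \<open>\<open>ip f (avg f)\<close> is the mean of the squared norms after a round, and
  Cauchy-Schwarz with \<open>sqn_avg_le\<close> bounds it by \<open>\<rho> * sqn f\<close>. Some
  round does not exceed the mean.\<close>

lemma exists_contracting_round:
  assumes mean: "measure_pmf.expectation \<mu> f = 0"
  obtains s where "s \<in> I" "sqn (fold heat (R s) f) \<le> \<rho> * sqn f"
proof -
  have "(ip f (avg f))\<^sup>2 \<le> sqn f * (\<rho>\<^sup>2 * sqn f)"
    using Cauchy_Schwarz[of f "avg f"] mult_left_mono[OF sqn_avg_le[OF mean] sqn_nonneg[of f]] by linarith
  also have "\<dots> = (\<rho> * sqn f)\<^sup>2" by (simp add: power2_eq_square)
  finally have "ip f (avg f) \<le> \<rho> * sqn f"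
    by (rule power2_le_imp_le) (use \<rho> sqn_nonneg[of f] in simp)
  then have "(\<Sum>s\<in>I. sqn (fold heat (R s) f)) \<le> \<rho> * sqn f * card I"
    using card_I by (simp add: avg_selfadjoint[symmetric] ip_avg field_simps)
  then have "\<not> (\<Sum>s\<in>I. \<rho> * sqn f) < (\<Sum>s\<in>I. sqn (fold heat (R s) f))" by (simp add: mult.commute)
  then have "\<exists>s\<in>I. sqn (fold heat (R s) f) \<le> \<rho> * sqn f"
    using sum_strict_mono[OF I, of "\<lambda>_. \<rho> * sqn f" "\<lambda>s. sqn (fold heat (R s) f)"] by force
  then show ?thesis using that by blast
qed

text \<open>Greedy choice: each round is picked for the function left by the earlier ones, which
  still has mean zero.\<close>

lemma exists_contracting_rounds:
  assumes mean: "measure_pmf.expectation \<mu> f = 0"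
  shows "\<exists>ss. set ss \<subseteq> I \<and> length ss = T \<and> sqn (fold heat (concat (map R ss)) f) \<le> \<rho> ^ T * sqn f"
proof (induction T)
  case 0
  then show ?case by simp
next
  case (Suc T)
  then obtain ss where ss: "set ss \<subseteq> I" "length ss = T"
    "sqn (fold heat (concat (map R ss)) f) \<le> \<rho> ^ T * sqn f" by blast
  let ?g = "fold heat (concat (map R ss)) f"
  have "measure_pmf.expectation \<mu> ?g = 0"
    using expectation_fold_heat[of "concat (map R ss)" f] ss(1) block_subset mean by fastforce
  then obtain s where s: "s \<in> I" "sqn (fold heat (R s) ?g) \<le> \<rho> * sqn ?g"
    by (rule exists_contracting_round)
  have "\<rho> * sqn ?g \<le> \<rho> * (\<rho> ^ T * sqn f)" using ss(3) \<rho> by (intro mult_left_mono) auto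
  then have "sqn (fold heat (concat (map R (ss @ [s]))) f) \<le> \<rho> ^ Suc T * sqn f"
    using s(2) by (simp add: mult.assoc)
  then show ?case using ss s(1) by (intro exI[of _ "ss @ [s]"]) auto
qed

section \<open>Spread of the dependence set over several rounds\<close>

lemma fold_touch_subset_V:
  "\<forall>C\<in>set Cs. C \<subseteq> V \<Longrightarrow> U \<subseteq> V \<Longrightarrow> fold touch Cs U \<subseteq> V"
proof (induction Cs arbitrary: U)
  case (Cons C Cs)
  have "touch C U \<subseteq> V" using Cons.prems bd_subset[of C] by (auto simp: touch_def)
  then show ?case using Cons by simp
qed simp

text \<open>By separation the boundaries added during a round meet none of its blocks, so only
  blocks meeting the original \<open>U\<close> are triggered. A whole round, or any part of it, thus
  costs a single step of \<open>nb\<close>.\<close>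

lemma fold_touch_round:
  assumes s: "s \<in> I" and U: "U \<subseteq> V" and Cs: "set Cs \<subseteq> set (R s)"
  shows "fold touch Cs U \<subseteq> nb `` U"
proof -
  have "fold touch Cs U \<subseteq> U \<union> (\<Union>C\<in>{C \<in> set Cs. C \<inter> U \<noteq> {}}. bd C)"
    using Cs
  proof (induction Cs rule: rev_induct)
    case (snoc C Cs)
    let ?X = "fold touch Cs U"
    have C: "C \<in> set (R s)" and sub: "set Cs \<subseteq> set (R s)" using snoc.prems by simp_all
    have IH: "?X \<subseteq> U \<union> (\<Union>C\<in>{C \<in> set Cs. C \<inter> U \<noteq> {}}. bd C)" by (rule snoc.IH[OF sub])
    have "C \<inter> bd C' = {}" if "C' \<in> set Cs" for C'
      by (rule block_sep[OF s C subsetD[OF sub that]])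
    with IH have XC: "?X \<inter> C \<subseteq> U" by blast
    show ?case
    proof
      fix v assume "v \<in> fold touch (Cs @ [C]) U"
      then consider "v \<in> ?X" | "?X \<inter> C \<noteq> {}" "v \<in> bd C" by (auto simp: touch_def split: if_splits)
      then show "v \<in> U \<union> (\<Union>C'\<in>{C' \<in> set (Cs @ [C]). C' \<inter> U \<noteq> {}}. bd C')"
      proof cases
        case 1
        then have "v \<in> U \<union> (\<Union>C\<in>{C \<in> set Cs. C \<inter> U \<noteq> {}}. bd C)" using IH by (rule rev_subsetD)
        then show ?thesis by auto
      next
        case 2
        then have "C \<inter> U \<noteq> {}" using XC by blast
        with 2 show ?thesis by auto
      qed
    qed
  qed simp
  also have "\<dots> \<subseteq> nb `` U"
  proof
    fix v assume "v \<in> U \<union> (\<Union>C\<in>{C \<in> set Cs. C \<inter> U \<noteq> {}}. bd C)"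
    then consider "v \<in> U" | C w where "C \<in> set Cs" "w \<in> C" "w \<in> U" "v \<in> bd C" by blast
    then show "v \<in> nb `` U"
    proof cases
      case 1
      then show ?thesis using U nb(2) by blast
    next
      case 2
      then show ?thesis using nb_block[OF s, of C w v] Cs by blast
    qed
  qed
  finally show ?thesis .
qed

lemma fold_touch_rounds:
  "set ss \<subseteq> I \<Longrightarrow> U \<subseteq> V \<Longrightarrow> fold touch (concat (map R ss)) U \<subseteq> (nb ^^ length ss) `` U"
proof (induction ss arbitrary: U)
  case (Cons s ss)
  let ?U = "fold touch (R s) U"
  have "?U \<subseteq> V" using Cons.prems block_subset by (intro fold_touch_subset_V) auto
  then have "fold touch (concat (map R ss)) ?U \<subseteq> (nb ^^ length ss) `` ?U" using Cons by auto
  also have "\<dots> \<subseteq> (nb ^^ length ss) `` (nb `` U)"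
    using fold_touch_round[of s U "R s"] Cons.prems by auto
  also have "\<dots> = (nb ^^ length (s # ss)) `` U"
    by (simp add: relpow_commute flip: relcomp_Image)
  finally show ?case by simp
qed simp

lemma nb_relpow_mono: "j \<le> k \<Longrightarrow> U \<subseteq> V \<Longrightarrow> (nb ^^ j) `` U \<subseteq> (nb ^^ k) `` U"
proof (induction rule: dec_induct)
  case (step k)
  have sub: "(nb ^^ k) `` U \<subseteq> V" using nb(1) step.prems
    by (cases k) (auto dest: relpow_Suc_D2)
  have "(nb ^^ j) `` U \<subseteq> (nb ^^ k) `` U" using step by simp
  also have "\<dots> \<subseteq> nb `` ((nb ^^ k) `` U)" using sub nb(2) by blast
  finally show ?case by (simp add: relcomp_Image)
qed simp

text \<open>Meeting \<open>C\<close> forces \<open>U\<close> to contain a vertex from which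
  \<open>C\<close> is reached in \<open>length ss\<close> steps of \<open>nb\<close>. There are at
  most \<open>m ^ Suc (length ss)\<close> such vertices, the extra factor counting the points of
  \<open>C\<close>; the union bound concludes.\<close>

lemma prob_touch_le:
  assumes ss: "set ss \<subseteq> I" and eq: "concat (map R ss) = pre @ C # post"
    and \<U>: "set_pmf \<U> \<subseteq> Pow V" and \<delta>: "\<And>j. j \<in> V \<Longrightarrow> measure_pmf.prob \<U> {U. j \<in> U} \<le> \<delta>" "\<delta> \<ge> 0"
  shows "measure_pmf.prob \<U> {U. fold touch pre U \<inter> C \<noteq> {}} \<le> real (m ^ Suc (length ss)) * \<delta>"
proof -
  let ?T = "length ss"
  obtain s where s: "s \<in> I" "C \<in> set (R s)"
  proof -
    have "C \<in> set (concat (map R ss))" using eq by simp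
    then show ?thesis using that ss by auto
  qed
  \<comment> \<open>The prefix consists of complete rounds and an initial piece of the next one.
    That piece costs one more step, so \<open>length ss\<close> steps suffice.\<close>
  obtain ss1 s' xs xs' ss2 where split: "ss = ss1 @ s' # ss2" "R s' = xs @ xs'" "pre = concat (map R ss1) @ xs"
  proof -
    have "ss \<noteq> []" using eq by auto
    then obtain yss ys ys' zss where *: "map R ss = yss @ (ys @ ys') # zss" "pre = concat yss @ ys"
      using eq unfolding concat_eq_append_conv[of "map R ss" pre "C # post"] by auto
    from *(1) obtain ss1 s' ss2 where "ss = ss1 @ s' # ss2" "yss = map R ss1" "R s' = ys @ ys'"
      by (auto simp: map_eq_append_conv map_eq_Cons_conv)
    with *(2) show ?thesis by (intro that[of ss1 s' ss2 ys ys']) auto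
  qed
  have reach: "fold touch pre U \<subseteq> (nb ^^ ?T) `` U" if U: "U \<subseteq> V" for U
  proof -
    let ?U = "fold touch (concat (map R ss1)) U"
    have "?U \<subseteq> V" using ss split block_subset U by (intro fold_touch_subset_V) auto
    then have "fold touch pre U \<subseteq> nb `` ?U"
      using fold_touch_round[of s' ?U xs] ss split by auto
    also have "\<dots> \<subseteq> nb `` ((nb ^^ length ss1) `` U)"
      using fold_touch_rounds[of ss1 U] ss split U by auto
    also have "\<dots> = (nb ^^ Suc (length ss1)) `` U" by (simp add: relcomp_Image)
    also have "\<dots> \<subseteq> (nb ^^ ?T) `` U" using split U by (intro nb_relpow_mono) auto
    finally show ?thesis .
  qed
  define W where "W = (nb ^^ ?T)\<inverse> `` C \<inter> V"
  have CV: "C \<subseteq> V" "finite C" using block_subset[OF s] finite_V finite_subset by auto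
  have finW: "finite W" using finite_V by (simp add: W_def)
  have fin': "finite ((nb ^^ ?T)\<inverse> `` C)"
  proof (rule finite_subset)
    show "(nb ^^ ?T)\<inverse> `` C \<subseteq> V"
      using nb(1) CV(1) by (cases ?T) (auto dest: relpow_Suc_D2 simp del: relpow.simps(2))
  qed (rule finite_V)
  have "card W \<le> card ((nb ^^ ?T)\<inverse> `` C)" unfolding W_def using fin' by (intro card_mono) auto
  also have "\<dots> \<le> card C * m ^ ?T"
    by (rule card_Image_relpow_le[OF nb(1) finite_V CV(2,1) nb_deg])
  also have "\<dots> \<le> m ^ Suc ?T" using block_card[OF s] by simp
  finally have cardW: "card W \<le> m ^ Suc ?T" .
  have "measure_pmf.prob \<U> {U. fold touch pre U \<inter> C \<noteq> {}}
      = measure_pmf.prob \<U> ({U. fold touch pre U \<inter> C \<noteq> {}} \<inter> set_pmf \<U>)"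
    by (simp add: measure_Int_set_pmf)
  also have "\<dots> \<le> measure_pmf.prob \<U> (\<Union>w\<in>W. {U. w \<in> U})"
  proof (rule measure_pmf.finite_measure_mono)
    show "{U. fold touch pre U \<inter> C \<noteq> {}} \<inter> set_pmf \<U> \<subseteq> (\<Union>w\<in>W. {U. w \<in> U})"
    proof
      fix U assume U: "U \<in> {U. fold touch pre U \<inter> C \<noteq> {}} \<inter> set_pmf \<U>"
      then have "U \<subseteq> V" using \<U> by blast
      obtain v where v: "v \<in> fold touch pre U" "v \<in> C" using U by blast
      then have "v \<in> (nb ^^ ?T) `` U" using reach[OF \<open>U \<subseteq> V\<close>] by blast
      then obtain w where "w \<in> U" "(w, v) \<in> nb ^^ ?T" by blast
      with v \<open>U \<subseteq> V\<close> show "U \<in> (\<Union>w\<in>W. {U. w \<in> U})" unfolding W_def by blast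
    qed
  qed simp
  also have "\<dots> \<le> (\<Sum>w\<in>W. measure_pmf.prob \<U> {U. w \<in> U})"
    by (rule measure_pmf.finite_measure_subadditive_finite[OF finW]) auto
  also have "\<dots> \<le> real (card W) * \<delta>"
    by (rule sum_bounded_above) (use \<delta> in \<open>auto simp: W_def\<close>)
  also have "\<dots> \<le> real (m ^ Suc ?T) * \<delta>"
    using cardW \<delta>(2) by (intro mult_right_mono) (auto simp only: of_nat_le_iff)
  finally show ?thesis .
qed

end

section \<open>The expected clue\<close>

lemma space_coord_algebra [simp]: "space (coord_algebra U) = UNIV"
  by (simp add: coord_algebra_def)

text \<open>No generating event separates configurations that agree on \<open>U\<close>, and this
  persists throughout the sigma-algebra, in particular for the level set of \<open>h\<close> through
  \<open>x\<close>.\<close>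

lemma coord_algebra_measurable_eq:
  fixes h :: "('v \<Rightarrow> 's) \<Rightarrow> real"
  assumes h: "h \<in> borel_measurable (coord_algebra U)" and eq: "\<And>v. v \<in> U \<Longrightarrow> x v = y v"
  shows "h x = h y"
proof -
  have inv: "x \<in> A \<longleftrightarrow> y \<in> A" if "A \<in> sigma_sets UNIV {(\<lambda>\<sigma>. \<sigma> v) -` A | v A. v \<in> U}" for A
    using that
  proof induction
    case (Basic a)
    then show ?case using eq by auto
  qed auto
  have "h -` {h x} \<inter> space (coord_algebra U) \<in> sets (coord_algebra U)"
    using h by (rule measurable_sets) simp
  then have "h -` {h x} \<in> sigma_sets UNIV {(\<lambda>\<sigma>. \<sigma> v) -` A | v A. v \<in> U}"
    by (simp add: coord_algebra_def)
  from inv[OF this] show ?thesis by simp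
qed

context spin_system
begin

lemma variance_eq_sqn:
  "measure_pmf.variance \<mu> f = sqn (\<lambda>x. f x - measure_pmf.expectation \<mu> f)"
  by (simp add: ip_def power2_eq_square)

text \<open>The covariance of \<open>f\<close> with its conditional expectation \<open>h\<close> is
  the variance of \<open>h\<close>. The covariance estimate thus bounds the square of that variance,
  and one factor cancels.\<close>

lemma variance_cond_exp_le_leak:
  assumes Cs: "\<forall>C\<in>set Cs. C \<subseteq> V" and U: "U \<subseteq> V"
  shows "measure_pmf.variance \<mu> (real_cond_exp (measure_pmf \<mu>) (coord_algebra U) f)
    \<le> leak Cs U (\<lambda>x. f x - measure_pmf.expectation \<mu> f)"
proof -
  interpret finite_measure_subalgebra "measure_pmf \<mu>" "coord_algebra U"
    by standard (simp add: subalgebra_def)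
  define h where "h = real_cond_exp (measure_pmf \<mu>) (coord_algebra U) f"
  define e where "e = measure_pmf.expectation \<mu> f"
  have h_meas: "h \<in> borel_measurable (coord_algebra U)" by (simp add: h_def)
  have he: "measure_pmf.expectation \<mu> h = e"
    unfolding h_def e_def by (rule real_cond_exp_int) simp
  have hh: "measure_pmf.expectation \<mu> (\<lambda>x. h x * h x) = measure_pmf.expectation \<mu> (\<lambda>x. h x * f x)"
    using real_cond_exp_intg(2)[of h f] h_meas by (simp add: h_def)
  let ?f = "\<lambda>x. f x - e" and ?h = "\<lambda>x. h x - e"
  have ip: "ip ?f ?h = sqn ?h"
    by (simp add: ip_def algebra_simps he hh[symmetric] e_def[symmetric])
      (simp add: hh mult.commute)
  have "depends U ?h"
    unfolding depends_def using coord_algebra_measurable_eq[OF h_meas] by metis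
  from ip_sq_le_leak[OF Cs this U, of ?f] have "sqn ?h * sqn ?h \<le> leak Cs U ?f * sqn ?h"
    by (simp add: ip power2_eq_square)
  then have "sqn ?h \<le> leak Cs U ?f"
    using sqn_nonneg[of ?h] leak_nonneg[of Cs U ?f] by (cases "sqn ?h = 0") auto
  then show ?thesis
    unfolding h_def[symmetric] he by (simp add: ip_def power2_eq_square e_def)
qed

end

context block_rounds
begin

text \<open>The number \<open>T\<close> of rounds is free: more rounds lower the remaining norm but
  raise the factor in front of the revealment. Neither term involves the size of
  \<open>V\<close>.\<close>

lemma expected_clue_le:
  assumes \<U>: "set_pmf \<U> \<subseteq> Pow V" and \<delta>: "\<And>j. j \<in> V \<Longrightarrow> measure_pmf.prob \<U> {U. j \<in> U} \<le> \<delta>" "\<delta> \<ge> 0"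
  shows "measure_pmf.expectation \<U> (clue \<mu> f) \<le> real (m ^ Suc T) * \<delta> + \<rho> ^ T"
proof -
  define F where "F = (\<lambda>x. f x - measure_pmf.expectation \<mu> f)"
  have "measure_pmf.expectation \<mu> F = 0" by (simp add: F_def)
  from exists_contracting_rounds[OF this, of T] obtain ss where ss: "set ss \<subseteq> I" "length ss = T"
    "sqn (fold heat (concat (map R ss)) F) \<le> \<rho> ^ T * sqn F" by blast
  define Cs where "Cs = concat (map R ss)"
  have Cs: "\<forall>C\<in>set Cs. C \<subseteq> V" using ss(1) block_subset by (auto simp: Cs_def)
  let ?p = "real (m ^ Suc T) * \<delta>"
  have fin: "finite (set_pmf \<U>)" using \<U> finite_V by (meson finite_Pow_iff finite_subset)
  have p0: "?p \<ge> 0" using \<delta>(2) by simp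
  have "measure_pmf.expectation \<U> (\<lambda>U. leak Cs U F)
      \<le> ?p * (sqn F - sqn (fold heat Cs F)) + sqn (fold heat Cs F)"
    using Cs \<U>
  proof (rule expectation_leak_le)
    fix pre C post assume "Cs = pre @ C # post"
    from prob_touch_le[OF ss(1) this[unfolded Cs_def] \<U> \<delta>] ss(2)
    show "measure_pmf.prob \<U> {U. fold touch pre U \<inter> C \<noteq> {}} \<le> ?p" by simp
  qed
  also have "\<dots> \<le> ?p * sqn F + sqn (fold heat Cs F)"
    using mult_nonneg_nonneg[OF p0 sqn_nonneg[of "fold heat Cs F"]] by (simp add: right_diff_distrib)
  also have "\<dots> \<le> (?p + \<rho> ^ T) * sqn F"
    using ss(3) by (simp add: Cs_def distrib_right)
  finally have leak: "measure_pmf.expectation \<U> (\<lambda>U. leak Cs U F) \<le> (?p + \<rho> ^ T) * sqn F" .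
  have "measure_pmf.expectation \<U> (clue \<mu> f) \<le> measure_pmf.expectation \<U> (\<lambda>U. leak Cs U F / sqn F)"
  proof (rule expectation_mono_pmf[OF fin])
    fix U assume "U \<in> set_pmf \<U>"
    then have "U \<subseteq> V" using \<U> by blast
    from variance_cond_exp_le_leak[OF Cs this, of f]
    show "clue \<mu> f U \<le> leak Cs U F / sqn F"
      unfolding clue_def variance_eq_sqn[of f] F_def[symmetric]
      by (rule divide_right_mono) (rule sqn_nonneg)
  qed
  also have "\<dots> = measure_pmf.expectation \<U> (\<lambda>U. leak Cs U F) / sqn F" by simp
  also have "\<dots> \<le> ?p + \<rho> ^ T"
  proof (cases "sqn F = 0")
    \<comment> \<open>Division by zero makes the quotient 0, as in \<open>clue\<close>.\<close>
    case True
    then show ?thesis using p0 \<rho> by simp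
  next
    case False
    then have "sqn F > 0" using sqn_nonneg[of F] by linarith
    then show ?thesis using leak by (simp add: field_simps)
  qed
  finally show ?thesis .
qed

end

section \<open>Blocks in the torus and in the box\<close>

text \<open>Congruence modulo \<open>per g n\<close> describes both geometries, since congruence modulo \<open>0\<close> is
  equality.\<close>

definition per :: "geometry \<Rightarrow> nat \<Rightarrow> int" where
  "per g n = (case g of Torus \<Rightarrow> int n | Box \<Rightarrow> 0)"

definition side :: "geometry \<Rightarrow> nat \<Rightarrow> int" where
  "side g n = (case g of Torus \<Rightarrow> int n | Box \<Rightarrow> int n + 1)"

lemma in_verts: "x \<in> verts g n \<longleftrightarrow> (\<forall>i. 0 \<le> x i \<and> x i < side g n)"
  by (cases g) (auto simp: side_def)

lemma finite_verts: "finite (verts g n :: ('d::finite) vertex set)"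
proof -
  have "verts g n = (UNIV :: 'd set) \<rightarrow>\<^sub>E {0..<side g n}" by (auto simp: in_verts PiE_iff)
  then show ?thesis by (simp add: finite_PiE)
qed

lemma per_mod:
  assumes "0 \<le> a" "a < side g n"
  shows "a mod per g n = a"
  using assms by (cases g) (auto simp: per_def side_def)

lemma edges_subset: "edges g n \<subseteq> verts g n \<times> verts g n"
  by (auto simp: edges_def)

lemma edges_step:
  assumes "(x, y) \<in> edges g n"
  obtains i t where "\<bar>t\<bar> = 1" "per g n dvd y i - x i - t" "\<And>j. j \<noteq> i \<Longrightarrow> y j = x j"
proof -
  have adj: "adj g n x y" using assms by (simp add: edges_def)
  show thesis
  proof (cases g)
    case Torus
    then obtain i where i: "\<forall>j. j \<noteq> i \<longrightarrow> x j = y j"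
      "y i mod int n = (x i + 1) mod int n \<or> x i mod int n = (y i + 1) mod int n"
      using adj by auto
    from i(2) show thesis
    proof
      assume "y i mod int n = (x i + 1) mod int n"
      then have "int n dvd y i - (x i + 1)" by (simp add: mod_eq_dvd_iff)
      then show thesis using that[of 1 i] i(1) Torus by (simp add: per_def algebra_simps)
    next
      assume "x i mod int n = (y i + 1) mod int n"
      then have "int n dvd x i - (y i + 1)" by (simp add: mod_eq_dvd_iff)
      then have "int n dvd y i - x i - (- 1)"
        by (subst dvd_minus_iff[symmetric]) (simp add: algebra_simps)
      then show thesis using that[of "- 1" i] i(1) Torus by (simp add: per_def)
    qed
  next
    case Box
    then obtain i where "\<forall>j. j \<noteq> i \<longrightarrow> x j = y j" "\<bar>x i - y i\<bar> = 1" using adj by auto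
    then show thesis using that[of "y i - x i" i] by (simp add: abs_minus_commute)
  qed
qed

lemma edges_move:
  assumes "x \<in> verts g n" "x(i := x i + t) \<in> verts g n" "\<bar>t\<bar> = 1"
  shows "(x, x(i := x i + t)) \<in> edges g n"
proof (cases g)
  case Torus
  have "x \<noteq> x(i := x i + t)" using assms(3) by (auto simp: fun_eq_iff intro!: exI[of _ i])
  moreover have "t = 1 \<or> t = - 1" using assms(3) by linarith
  ultimately show ?thesis using assms Torus
    by (auto simp: edges_def simp del: verts.simps intro!: exI[of _ i])
next
  case Box
  then show ?thesis using assms by (auto simp: edges_def simp del: verts.simps intro!: exI[of _ i])
qed

text \<open>Moving a differing coordinate by one towards its target, never around the torus, stays
  in range and reduces the l1 distance. This is needed because \<open>graph_dist\<close>, a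
  \<open>LEAST\<close>, is meaningful only for joined vertices.\<close>

lemma connected:
  fixes x y :: "('d::finite) vertex"
  assumes "x \<in> verts g n" "y \<in> verts g n"
  shows "\<exists>k. (x, y) \<in> edges g n ^^ k"
  using assms(1)
proof (induction "\<Sum>i\<in>UNIV. nat \<bar>x i - y i\<bar>" arbitrary: x rule: less_induct)
  case less
  show ?case
  proof (cases "x = y")
    case True
    then show ?thesis by (intro exI[of _ 0]) simp
  next
    case False
    then obtain i where i: "x i \<noteq> y i" by auto
    define t where "t = sgn (y i - x i)"
    define z where "z = x(i := x i + t)"
    have t: "\<bar>t\<bar> = 1" using i by (auto simp: t_def sgn_if)
    have zi: "(x i < y i \<and> z i = x i + 1) \<or> (y i < x i \<and> z i = x i - 1)"
      using i by (auto simp: t_def z_def sgn_if)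
    have z: "z \<in> verts g n"
      unfolding in_verts
    proof
      fix j
      show "0 \<le> z j \<and> z j < side g n"
      proof (cases "j = i")
        case True
        have "0 \<le> x i" "x i < side g n" "0 \<le> y i" "y i < side g n"
          using less.prems assms(2) unfolding in_verts by auto
        then show ?thesis using zi True by auto
      next
        case False
        then show ?thesis using less.prems unfolding in_verts z_def by simp
      qed
    qed
    have e: "(x, z) \<in> edges g n"
      using edges_move[OF less.prems z[unfolded z_def] t] by (simp add: z_def)
    have "(\<Sum>j\<in>UNIV. nat \<bar>z j - y j\<bar>) < (\<Sum>j\<in>UNIV. nat \<bar>x j - y j\<bar>)"
    proof (rule sum_strict_mono_ex1)
      show "\<forall>j\<in>UNIV. nat \<bar>z j - y j\<bar> \<le> nat \<bar>x j - y j\<bar>"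
      proof
        fix j
        show "nat \<bar>z j - y j\<bar> \<le> nat \<bar>x j - y j\<bar>"
        proof (cases "j = i")
          case True
          then show ?thesis using zi by auto
        qed (simp add: z_def)
      qed
      show "\<exists>j\<in>UNIV. nat \<bar>z j - y j\<bar> < nat \<bar>x j - y j\<bar>"
        using zi by (intro bexI[of _ i]) auto
    qed simp
    from less.hyps[OF this z] obtain k where "(z, y) \<in> edges g n ^^ k" ..
    with e have "(x, y) \<in> edges g n ^^ Suc k" by (rule relpow_Suc_I2)
    then show ?thesis ..
  qed
qed

text \<open>Sup-norm balls modulo the period: they contain the graph balls and are easy to
  count.\<close>

definition near :: "geometry \<Rightarrow> nat \<Rightarrow> int \<Rightarrow> ('d vertex \<times> 'd vertex) set" where
  "near g n k = {(x, y). x \<in> verts g n \<and> y \<in> verts g n \<and>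
     (\<forall>i. \<exists>t. \<bar>t\<bar> \<le> k \<and> per g n dvd y i - x i - t)}"

lemma nearI:
  assumes "x \<in> verts g n" "y \<in> verts g n" "\<And>i. \<exists>t. \<bar>t\<bar> \<le> k \<and> per g n dvd y i - x i - t"
  shows "(x, y) \<in> near g n k"
  using assms by (simp add: near_def)

lemma near_refl: "k \<ge> 0 \<Longrightarrow> Id_on (verts g n) \<subseteq> near g n k"
  by (auto intro!: nearI exI[of _ 0])

lemma near_converse: "(near g n k)\<inverse> \<subseteq> near g n k"
proof
  fix p :: "'a vertex \<times> 'a vertex" assume "p \<in> (near g n k)\<inverse>"
  then obtain x y where p: "p = (y, x)" and xy: "(x, y) \<in> near g n k" by auto
  have "(y, x) \<in> near g n k"
  proof (rule nearI)
    show "y \<in> verts g n" "x \<in> verts g n" using xy by (auto simp: near_def)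
    fix i
    obtain t where t: "\<bar>t\<bar> \<le> k" "per g n dvd y i - x i - t" using xy unfolding near_def by auto
    have "per g n dvd - (y i - x i - t)" using t(2) by (simp only: dvd_minus_iff)
    then show "\<exists>t. \<bar>t\<bar> \<le> k \<and> per g n dvd x i - y i - t"
      using t(1) by (intro exI[of _ "- t"]) (simp add: algebra_simps)
  qed
  then show "p \<in> near g n k" by (simp add: p)
qed

lemma near_mono: "k \<le> k' \<Longrightarrow> near g n k \<subseteq> near g n k'"
  unfolding near_def by (safe, meson order_trans)

lemma card_near_le:
  assumes x: "x \<in> verts g n" and k: "k \<ge> 0"
  shows "card (near g n k `` {x :: ('d::finite) vertex}) \<le> nat (2 * k + 1) ^ CARD('d)"
proof -
  let ?T = "(UNIV :: 'd set) \<rightarrow>\<^sub>E {-k..k}"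
  have fin: "finite ?T" by (simp add: finite_PiE)
  have "near g n k `` {x} \<subseteq> (\<lambda>t i. (x i + t i) mod per g n) ` ?T"
  proof
    fix y assume "y \<in> near g n k `` {x}"
    then have y: "y \<in> verts g n" and ex: "\<forall>i. \<exists>t. \<bar>t\<bar> \<le> k \<and> per g n dvd y i - x i - t"
      by (auto simp: near_def)
    from choice[OF ex] obtain t where t: "\<And>i. \<bar>t i\<bar> \<le> k" "\<And>i. per g n dvd y i - x i - t i" by blast
    have "y = (\<lambda>i. (x i + t i) mod per g n)"
    proof
      fix i
      have "y i mod per g n = (x i + t i) mod per g n" using t(2)[of i] by (simp add: mod_eq_dvd_iff algebra_simps)
      then show "y i = (x i + t i) mod per g n" using y per_mod[of "y i" g n] by (simp add: in_verts)
    qed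
    moreover have "t \<in> ?T" using t(1) by (auto simp: PiE_iff abs_le_iff minus_le_iff)
    ultimately show "y \<in> (\<lambda>t i. (x i + t i) mod per g n) ` ?T" by (rule image_eqI)
  qed
  then have "card (near g n k `` {x}) \<le> card ?T" using fin by (meson card_image_le card_mono finite_imageI le_trans)
  also have "\<dots> = nat (2 * k + 1) ^ CARD('d)" using k by (simp add: card_PiE)
  finally show ?thesis .
qed

lemma near_relpow:
  assumes "x \<in> verts g n" "(x, y) \<in> edges g n ^^ k"
  shows "(x, y) \<in> near g n (int k)"
  using assms(2)
proof (induction k arbitrary: y)
  case 0
  then show ?case using assms(1) near_refl[of 0 g n] by auto
next
  case (Suc k)
  then obtain z where z: "(x, z) \<in> edges g n ^^ k" "(z, y) \<in> edges g n" by auto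
  have xz: "(x, z) \<in> near g n (int k)" using Suc.IH z(1) .
  obtain i t where it: "\<bar>t\<bar> = 1" "per g n dvd y i - z i - t" "\<And>j. j \<noteq> i \<Longrightarrow> y j = z j"
    using edges_step[OF z(2)] by blast
  show ?case
  proof (rule nearI[OF assms(1)])
    show "y \<in> verts g n" using z(2) by (auto simp: edges_def)
    fix j
    obtain s where s: "\<bar>s\<bar> \<le> int k" "per g n dvd z j - x j - s" using xz unfolding near_def by auto
    show "\<exists>t. \<bar>t\<bar> \<le> int (Suc k) \<and> per g n dvd y j - x j - t"
    proof (cases "j = i")
      case True
      have "per g n dvd (y j - z j - t) + (z j - x j - s)" using it(2) s(2) True by (intro dvd_add) auto
      then show ?thesis using it(1) s(1) by (intro exI[of _ "t + s"]) (simp add: algebra_simps)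
    next
      case False
      then show ?thesis using it(3) s by (intro exI[of _ s]) auto
    qed
  qed
qed

lemma graph_dist_near:
  fixes x y :: "('d::finite) vertex"
  assumes "x \<in> verts g n" "y \<in> verts g n"
  shows "(x, y) \<in> near g n (int (graph_dist (edges g n) x y))"
  unfolding graph_dist_def by (rule near_relpow[OF assms(1) LeastI_ex[OF connected[OF assms]]])

text \<open>One formula for cubes that wrap around the torus and cubes in the box. In the box, a
  corner too near the border would truncate the cube; \<open>block_in_cubes\<close> excludes
  this.\<close>

definition block :: "geometry \<Rightarrow> nat \<Rightarrow> 'd vertex \<Rightarrow> int \<Rightarrow> 'd vertex set" where
  "block g n a l = {x \<in> verts g n. \<forall>i. \<exists>t. 0 \<le> t \<and> t < l \<and> per g n dvd x i - a i - t}"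

lemma block_in_cubes:
  assumes l: "1 \<le> l" "l \<le> int n" and a: "g = Box \<Longrightarrow> \<forall>i. 0 \<le> a i \<and> a i + l \<le> int n + 1"
  shows "block g n a l \<in> cubes g n"
proof (cases g)
  case Torus
  have "block g n a l = (\<lambda>x i. x i mod int n) ` cube a (nat l)"
  proof (intro equalityI subsetI)
    fix x assume "x \<in> block g n a l"
    then have x: "x \<in> verts g n" and ex: "\<forall>i. \<exists>t. 0 \<le> t \<and> t < l \<and> int n dvd x i - a i - t"
      by (auto simp: block_def per_def Torus simp del: verts.simps)
    from choice[OF ex] obtain t where t: "\<And>i. 0 \<le> t i" "\<And>i. t i < l" "\<And>i. int n dvd x i - a i - t i"
      by blast
    have "x = (\<lambda>i. (a i + t i) mod int n)"
    proof
      fix i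
      have "x i mod int n = (a i + t i) mod int n" using t(3)[of i] by (simp add: mod_eq_dvd_iff algebra_simps)
      then show "x i = (a i + t i) mod int n" using x by (simp add: Torus)
    qed
    moreover have "(\<lambda>i. a i + t i) \<in> cube a (nat l)" using t l by (simp add: cube_def)
    ultimately show "x \<in> (\<lambda>x i. x i mod int n) ` cube a (nat l)" by (rule image_eqI)
  next
    fix x assume "x \<in> (\<lambda>x i. x i mod int n) ` cube a (nat l)"
    then obtain y where y: "y \<in> cube a (nat l)" "x = (\<lambda>i. y i mod int n)" by auto
    have "0 \<le> y i - a i \<and> y i - a i < l \<and> int n dvd x i - a i - (y i - a i)" for i
      using y l by (auto simp: cube_def simp flip: mod_eq_dvd_iff) (smt (verit))
    then have "\<forall>i. \<exists>t. 0 \<le> t \<and> t < l \<and> int n dvd x i - a i - t" by blast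
    moreover have "x \<in> verts g n" using y l by (simp add: Torus)
    ultimately show "x \<in> block g n a l" by (simp add: block_def per_def Torus)
  qed
  then show ?thesis using l Torus by (auto intro!: exI[of _ a] exI[of _ "nat l"])
next
  case Box
  have "block g n a l = cube a (nat l)"
  proof (intro equalityI subsetI)
    fix x assume "x \<in> block g n a l"
    then have "\<forall>i. \<exists>t. 0 \<le> t \<and> t < l \<and> x i = a i + t"
      by (auto simp: block_def per_def Box algebra_simps simp del: verts.simps)
    then have "a i \<le> x i \<and> x i < a i + l" for i by (elim allE[of _ i]) auto
    then show "x \<in> cube a (nat l)" using l by (simp add: cube_def)
  next
    fix x assume "x \<in> cube a (nat l)"
    then have x: "\<And>i. a i \<le> x i \<and> x i < a i + l" using l by (simp add: cube_def)
    have "x \<in> verts g n" unfolding Box verts.simps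
    proof (intro CollectI allI)
      fix i show "0 \<le> x i \<and> x i \<le> int n" using x[of i] a[OF Box, rule_format, of i] by linarith
    qed
    moreover have "\<exists>t. 0 \<le> t \<and> t < l \<and> per g n dvd x i - a i - t" for i
      using x[of i] by (intro exI[of _ "x i - a i"]) auto
    ultimately show "x \<in> block g n a l" unfolding block_def by blast
  qed
  moreover have "block g n a l \<subseteq> verts Box n" by (auto simp: block_def Box simp del: verts.simps)
  ultimately show ?thesis using l Box by (auto intro!: exI[of _ a] exI[of _ "nat l"] simp del: verts.simps)
qed

lemma block_subset: "block g n a l \<subseteq> verts g n"
  by (auto simp: block_def simp del: verts.simps)

text \<open>An edge leaving the block changes one coordinate by one. The new offset cannot lie
  between 0 and \<open>l - 1\<close>, as \<open>u\<close> would then belong to the block, so it is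
  -1 or \<open>l\<close>.\<close>

lemma ext_boundary_block:
  assumes "u \<in> ext_boundary (edges g n) (block g n a l)"
  shows "u \<in> verts g n" "u \<notin> block g n a l"
    and "\<exists>t. - 1 \<le> t \<and> t \<le> l \<and> per g n dvd u i - a i - t"
    and "\<exists>i. per g n dvd u i - (a i - 1) \<or> per g n dvd u i - (a i + l)"
proof -
  obtain y where y: "y \<in> block g n a l" "(y, u) \<in> edges g n" and u: "u \<notin> block g n a l"
    using assms by (auto simp: ext_boundary_def)
  show uV: "u \<in> verts g n" using y(2) edges_subset[of g n] by blast
  show "u \<notin> block g n a l" by (rule u)
  obtain k s where ks: "\<bar>s\<bar> = 1" "per g n dvd u k - y k - s" "\<And>j. j \<noteq> k \<Longrightarrow> u j = y j"
    using edges_step[OF y(2)] by blast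
  have yt: "\<exists>t. 0 \<le> t \<and> t < l \<and> per g n dvd y i - a i - t" for i using y(1) by (simp add: block_def)
  obtain t where t: "0 \<le> t" "t < l" "per g n dvd y k - a k - t" using yt by blast
  have tk: "per g n dvd u k - a k - (t + s)"
  proof -
    have "per g n dvd (u k - y k - s) + (y k - a k - t)" using ks(2) t(3) by (rule dvd_add)
    then show ?thesis by (simp add: algebra_simps)
  qed
  show "\<exists>t. - 1 \<le> t \<and> t \<le> l \<and> per g n dvd u i - a i - t"
  proof (cases "i = k")
    case True
    then show ?thesis using tk t ks(1) by (intro exI[of _ "t + s"]) auto
  next
    case False
    obtain t' where "0 \<le> t'" "t' < l" "per g n dvd y i - a i - t'" using yt by blast
    then show ?thesis using ks(3)[OF False] by (intro exI[of _ t']) auto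
  qed
  have "\<not> (0 \<le> t + s \<and> t + s < l)"
  proof
    assume "0 \<le> t + s \<and> t + s < l"
    then have "\<exists>t. 0 \<le> t \<and> t < l \<and> per g n dvd u i - a i - t" for i
      using tk yt[of i] ks(3)[of i] by (cases "i = k") auto
    then show False using u uV by (simp add: block_def)
  qed
  then have "t + s = - 1 \<or> t + s = l" using t ks(1) by linarith
  then have "u k - a k - (t + s) = u k - (a k - 1) \<or> u k - a k - (t + s) = u k - (a k + l)" by auto
  then show "\<exists>i. per g n dvd u i - (a i - 1) \<or> per g n dvd u i - (a i + l)"
    using tk by metis
qed

lemma near_of_cong:
  assumes "per g n dvd x - a - t" "per g n dvd y - a - t'"
  shows "per g n dvd y - x - (t' - t)"
  using dvd_diff[OF assms(2,1)] by (simp add: algebra_simps)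

section \<open>Random intervals in one coordinate\<close>

text \<open>A random family of intervals of length \<open>l\<close> in one coordinate, given by their left endpoints.
  On the torus the family is a randomly shifted arithmetic progression.  In the box it is, with
  probability \<open>1/3\<close> each, such a progression, the leftmost interval, or the rightmost interval; the
  endpoints of the latter two are spread out by the randomness of \<open>l\<close>.\<close>

definition index1 :: "geometry \<Rightarrow> nat \<Rightarrow> int \<Rightarrow> int set" where
  "index1 g n L = (case g of Torus \<Rightarrow> {0..<int n} | Box \<Rightarrow> {0..<12 * L})"

text \<open>As \<open>l < 2 * L\<close>, the spacing \<open>4 * L\<close> keeps intervals and their
  boundary points apart; rounding the number of intervals down preserves it across the wrap-around.
  The end intervals of the box serve vertices near the border, which a progression seldom
  covers.\<close>

definition starts :: "geometry \<Rightarrow> nat \<Rightarrow> int \<Rightarrow> int \<Rightarrow> int \<Rightarrow> int set" where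
  "starts g n L l j = (case g of
     Torus \<Rightarrow> (\<lambda>k. j + 4 * L * k) ` {0..<int n div (4 * L)}
   | Box \<Rightarrow> if j < 4 * L then {a. 4 * L dvd a - j \<and> 0 \<le> a \<and> a + l \<le> int n + 1}
            else if j < 8 * L then {0} else {int n + 1 - l})"

definition covers1 :: "geometry \<Rightarrow> nat \<Rightarrow> int \<Rightarrow> int \<Rightarrow> int \<Rightarrow> int set" where
  "covers1 g n L l x = {j \<in> index1 g n L.
     \<exists>a\<in>starts g n L l j. \<exists>t. 0 \<le> t \<and> t < l \<and> per g n dvd x - a - t}"

definition meets1 :: "geometry \<Rightarrow> nat \<Rightarrow> int \<Rightarrow> int \<Rightarrow> int \<Rightarrow> int set" where
  "meets1 g n L l x = {j \<in> index1 g n L.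
     \<exists>a\<in>starts g n L l j. per g n dvd x - (a - 1) \<or> per g n dvd x - (a + l)}"

lemma finite_index1: "finite (index1 g n L)"
  by (simp add: index1_def split: geometry.split)

lemma finite_covers1: "finite (covers1 g n L l x)"
  using finite_index1[of g n L] by (simp add: covers1_def)

lemma finite_starts: "finite (starts g n L l j)"
proof -
  have "finite {a. 4 * L dvd a - j \<and> 0 \<le> a \<and> a + l \<le> int n + 1}"
    by (rule finite_subset[of _ "{0..int n + 1 - l}"]) auto
  then show ?thesis by (simp add: starts_def split: geometry.split)
qed

context
  fixes L :: int and n :: nat
  assumes L: "1 \<le> L" and n: "4 * L \<le> int n"
begin

lemma starts_box:
  assumes "L \<le> l" "l < 2 * L" "a \<in> starts Box n L l j"
  shows "0 \<le> a \<and> a + l \<le> int n + 1"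
  using assms L n by (auto simp: starts_def split: if_splits)

lemma small_multiple_eq_0:
  fixes z :: int
  assumes "m dvd z" "\<bar>z\<bar> < m"
  shows "z = 0"
  by (rule ccontr) (use dvd_imp_le_int[of z m] assms in linarith)

lemma mult_div_le: "4 * L * (int n div (4 * L)) \<le> int n"
  using mult_div_mod_eq[of "4 * L" "int n"] pos_mod_sign[of "4 * L" "int n"] L by linarith

lemma progression_bounds:
  fixes k :: int
  assumes "0 \<le> k" "k < int n div (4 * L)"
  shows "0 \<le> 4 * L * k" "4 * L * k \<le> int n - 4 * L"
proof -
  show "0 \<le> 4 * L * k" using assms L by simp
  have "4 * L * (k + 1) \<le> 4 * L * (int n div (4 * L))" using assms L by (intro mult_left_mono) auto
  also have "\<dots> \<le> int n" by (rule mult_div_le)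
  finally show "4 * L * k \<le> int n - 4 * L" by (simp add: algebra_simps)
qed

text \<open>The largest difference of two offsets between -1 and \<open>l\<close> is
  \<open>l + 1\<close>, so this separates intervals enlarged by their boundary points. It is below
  the spacing \<open>4 * L\<close>, which divides all differences within a progression.\<close>

lemma starts_separated:
  assumes l: "L \<le> l" "l < 2 * L" and a: "a \<in> starts g n L l j" "a' \<in> starts g n L l j"
    and t: "\<bar>t\<bar> \<le> l + 1" "per g n dvd a - a' - t"
  shows "a = a'"
proof (cases g)
  case Torus
  then obtain k k' where k: "0 \<le> k" "k < int n div (4 * L)" "0 \<le> k'" "k' < int n div (4 * L)"
    "a = j + 4 * L * k" "a' = j + 4 * L * k'"
    using a by (auto simp: starts_def)
  note b = progression_bounds[OF k(1,2)] progression_bounds[OF k(3,4)]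
  have "\<bar>a - a' - t\<bar> < int n" using b t(1) l L k(5,6) by linarith
  then have "a - a' - t = 0" using t(2) Torus by (intro small_multiple_eq_0[of "int n"]) (auto simp: per_def)
  then have "\<bar>a - a'\<bar> < 4 * L" using t(1) l L by linarith
  moreover have "4 * L dvd a - a'" using k by (simp flip: right_diff_distrib)
  ultimately show ?thesis using small_multiple_eq_0[of "4 * L" "a - a'"] by simp
next
  case Box
  then have "a - a' = t" using t by (simp add: per_def)
  then have less: "\<bar>a - a'\<bar> < 4 * L" using t(1) l L by linarith
  show ?thesis
  proof (cases "j < 4 * L")
    case True
    then have "4 * L dvd a - j" "4 * L dvd a' - j" using a Box by (simp_all add: starts_def)
    then have "4 * L dvd (a - j) - (a' - j)" by (rule dvd_diff)
    then show ?thesis using small_multiple_eq_0[of "4 * L" "a - a'"] less by simp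
  next
    case False
    then show ?thesis using a Box by (auto simp: starts_def split: if_splits)
  qed
qed

text \<open>On the torus the pairs of an offset below \<open>L\<close> and an interval number give
  distinct shifts. In the box at least \<open>L\<close> of the \<open>12 * L\<close> indices work:
  those of an end interval if \<open>x\<close> is near the border, otherwise those of
  \<open>L\<close> consecutive left endpoints.\<close>

lemma card_covers1:
  assumes l: "L \<le> l" "l < 2 * L" and x: "0 \<le> x" "x < side g n"
  shows "card (index1 g n L) \<le> 12 * card (covers1 g n L l x)"
proof (cases g)
  case Torus
  let ?q = "int n div (4 * L)"
  have q: "4 * L * ?q \<le> int n" "int n < 4 * L * ?q + 4 * L" "1 \<le> ?q"
  proof -
    have "int n = 4 * L * ?q + int n mod (4 * L)" by simp
    moreover have "0 \<le> int n mod (4 * L)" "int n mod (4 * L) < 4 * L" using L by auto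
    ultimately show "4 * L * ?q \<le> int n" "int n < 4 * L * ?q + 4 * L" by linarith+
    show "1 \<le> ?q" using n L by (simp add: pos_imp_zdiv_pos_iff int_one_le_iff_zero_less)
  qed
  let ?D = "{0..<L} \<times> {0..<?q}" and ?h = "\<lambda>(t, k). (x - t - 4 * L * k) mod int n"
  have "inj_on ?h ?D"
  proof (rule inj_onI)
    fix p p' assume "p \<in> ?D" "p' \<in> ?D" and eq: "?h p = ?h p'"
    then obtain t k t' k' where p: "p = (t, k)" "p' = (t', k')" and
      t: "0 \<le> t" "t < L" "0 \<le> t'" "t' < L" and k: "0 \<le> k" "k < ?q" "0 \<le> k'" "k' < ?q" by auto
    note b = progression_bounds[OF k(1,2)] progression_bounds[OF k(3,4)]
    have "int n dvd (x - t - 4 * L * k) - (x - t' - 4 * L * k')"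
      using eq p by (simp add: mod_eq_dvd_iff)
    moreover have "\<bar>(x - t - 4 * L * k) - (x - t' - 4 * L * k')\<bar> < int n" using b t by linarith
    ultimately have "(x - t - 4 * L * k) - (x - t' - 4 * L * k') = 0"
      by (rule small_multiple_eq_0)
    then have e: "4 * L * k - 4 * L * k' = t' - t" by linarith
    have "4 * L dvd 4 * L * k - 4 * L * k'" by (simp flip: right_diff_distrib)
    then have "4 * L dvd t' - t" by (simp add: e)
    moreover have "\<bar>t' - t\<bar> < 4 * L" using t by linarith
    ultimately have "t' - t = 0" by (rule small_multiple_eq_0)
    then show "p = p'" using e p L by simp
  qed
  then have cardh: "card (?h ` ?D) = nat L * nat ?q" by (simp add: card_image)
  have sub: "?h ` ?D \<subseteq> covers1 g n L l x"
  proof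
    fix j assume "j \<in> ?h ` ?D"
    then obtain t k where t: "0 \<le> t" "t < L" and k: "0 \<le> k" "k < ?q" and j: "j = (x - t - 4 * L * k) mod int n"
      by auto
    have "int n dvd x - (j + 4 * L * k) - t"
    proof -
      have "int n dvd (x - t - 4 * L * k) - j" unfolding j by (rule dvd_minus_mod)
      then show ?thesis by (simp add: algebra_simps)
    qed
    moreover have "j \<in> index1 g n L" using n L by (simp add: index1_def Torus j)
    moreover have "j + 4 * L * k \<in> starts g n L l j" 
      unfolding starts_def Torus geometry.case using k by (intro image_eqI[of _ _ k]) auto
    ultimately show "j \<in> covers1 g n L l x"
      unfolding covers1_def using t l by (auto simp: per_def Torus intro!: bexI[of _ "j + 4 * L * k"] exI[of _ t])
  qed
  have "nat L * nat ?q \<le> card (covers1 g n L l x)"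
    using card_mono[OF finite_covers1 sub] unfolding cardh .
  moreover have "n \<le> 12 * (nat L * nat ?q)"
  proof -
    have "L * 1 \<le> L * ?q" using q L by (intro mult_left_mono) auto
    moreover have "4 * L * ?q = 4 * (L * ?q)" by simp
    ultimately have "int n \<le> 12 * (L * ?q)" using q by linarith
    moreover have "int (nat L * nat ?q) = L * ?q" using L q(3) by simp
    ultimately show ?thesis by linarith
  qed
  moreover have "card (index1 g n L) = n" by (simp add: index1_def Torus)
  ultimately show ?thesis by linarith
next
  case Box
  have x': "x \<le> int n" using x by (simp add: side_def Box)
  note fin = finite_covers1[of g n L l x]
  have "nat L \<le> card (covers1 g n L l x)"
  proof -
    consider "x < L" | "x > int n - L" | "L \<le> x" "x \<le> int n - L" by linarith
    then show ?thesis
    proof cases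
      case 1
      have "{4 * L..<8 * L} \<subseteq> covers1 g n L l x"
        using 1 x l L by (auto simp: covers1_def index1_def starts_def per_def Box)
      from card_mono[OF fin this] show ?thesis using L by simp
    next
      case 2
      have "{8 * L..<12 * L} \<subseteq> covers1 g n L l x"
      proof
        fix j assume j: "j \<in> {8 * L..<12 * L}"
        then have "starts g n L l j = {int n + 1 - l}" using L by (simp add: starts_def Box)
        then show "j \<in> covers1 g n L l x" using 2 x' l L j
          by (auto simp: covers1_def index1_def per_def Box intro!: exI[of _ "x - (int n + 1 - l)"])
      qed
      from card_mono[OF fin this] show ?thesis using L by simp
    next
      case 3
      \<comment> \<open>These \<open>L\<close> left endpoints give intervals that contain
        \<open>x\<close> and fit in the box. The last one is \<open>x\<close>, or the rightmost
        admissible endpoint \<open>n + 1 - l\<close> if the interval from \<open>x\<close> would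
        overshoot.\<close>
      define c where "c = (if x + l \<le> int n + 1 then x + 1 - L else int n + 2 - l - L)"
      have sub: "(\<lambda>a. a mod (4 * L)) ` {c..<c + L} \<subseteq> covers1 g n L l x"
      proof
        fix j assume "j \<in> (\<lambda>a. a mod (4 * L)) ` {c..<c + L}"
        then obtain a where a: "c \<le> a" "a < c + L" and j: "j = a mod (4 * L)" by auto
        have a': "0 \<le> a" "a + l \<le> int n + 1" "0 \<le> x - a" "x - a < l"
          using a 3 l n L by (auto simp: c_def split: if_splits)
        have jb: "0 \<le> j" "j < 4 * L" using L by (auto simp: j)
        have "a \<in> starts g n L l j" using a' jb by (simp add: starts_def Box j dvd_minus_mod)
        moreover have "j \<in> index1 g n L" using jb by (simp add: index1_def Box)
        ultimately show "j \<in> covers1 g n L l x"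
          unfolding covers1_def using a' by (auto simp: per_def Box intro!: bexI[of _ a] exI[of _ "x - a"])
      qed
      have "inj_on (\<lambda>a. a mod (4 * L)) {c..<c + L}"
      proof (rule inj_onI)
        fix a a' assume a: "a \<in> {c..<c + L}" "a' \<in> {c..<c + L}" "a mod (4 * L) = a' mod (4 * L)"
        then have "4 * L dvd a - a'" by (simp add: mod_eq_dvd_iff)
        moreover have "\<bar>a - a'\<bar> < 4 * L" using a L by auto
        ultimately have "a - a' = 0" by (rule small_multiple_eq_0)
        then show "a = a'" by simp
      qed
      then have "card ((\<lambda>a. a mod (4 * L)) ` {c..<c + L}) = nat L" by (simp add: card_image)
      with card_mono[OF fin sub] show ?thesis by linarith
    qed
  qed
  moreover have "card (index1 g n L) = 12 * nat L" using L by (simp add: index1_def Box nat_mult_distrib)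
  ultimately show ?thesis by linarith
qed

text \<open>Averaged over the \<open>L\<close> lengths, a point is a boundary point with frequency
  at most 1/L. In the box the end intervals have \<open>x\<close> on their boundary only for the
  lengths \<open>x\<close> and \<open>n - x\<close>, which is why \<open>l\<close> is random; the
  total is at most 2 L + 4 L + 4 L.\<close>

lemma sum_card_meets1:
  assumes x: "0 \<le> x" "x < side g n"
  shows "(\<Sum>l\<in>{L..<2 * L}. card (meets1 g n L l x)) \<le> card (index1 g n L)"
proof (cases g)
  case Torus
  let ?q = "int n div (4 * L)"
  have card: "card (meets1 g n L l x) \<le> 2 * nat ?q" if l: "l \<in> {L..<2 * L}" for l
  proof -
    let ?A = "(\<lambda>k. (x + 1 - 4 * L * k) mod int n) ` {0..<?q}"
    let ?B = "(\<lambda>k. (x - l - 4 * L * k) mod int n) ` {0..<?q}"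
    have "meets1 g n L l x \<subseteq> ?A \<union> ?B"
    proof
      fix j assume "j \<in> meets1 g n L l x"
      then obtain k where j: "0 \<le> j" "j < int n" and k: "k \<in> {0..<?q}"
        and d: "int n dvd x - (j + 4 * L * k - 1) \<or> int n dvd x - (j + 4 * L * k + l)"
        by (auto simp: meets1_def index1_def starts_def per_def Torus)
      have jm: "j = j mod int n" using j by simp
      from d show "j \<in> ?A \<union> ?B"
      proof
        assume "int n dvd x - (j + 4 * L * k - 1)"
        then have "(x + 1 - 4 * L * k) mod int n = j mod int n" by (simp add: mod_eq_dvd_iff algebra_simps)
        then have "j = (x + 1 - 4 * L * k) mod int n" using jm by simp
        then show ?thesis using k by blast
      next
        assume "int n dvd x - (j + 4 * L * k + l)"
        then have "(x - l - 4 * L * k) mod int n = j mod int n" by (simp add: mod_eq_dvd_iff algebra_simps)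
        then have "j = (x - l - 4 * L * k) mod int n" using jm by simp
        then show ?thesis using k by blast
      qed
    qed
    then have "card (meets1 g n L l x) \<le> card (?A \<union> ?B)" by (intro card_mono) auto
    also have "\<dots> \<le> card ?A + card ?B" by (rule card_Un_le)
    also have "\<dots> \<le> nat ?q + nat ?q"
      by (intro add_mono) (use card_image_le[of "{0..<?q}"] in \<open>fastforce+\<close>)
    finally show ?thesis by simp
  qed
  have "(\<Sum>l\<in>{L..<2 * L}. card (meets1 g n L l x)) \<le> card {L..<2 * L} * (2 * nat ?q)"
    using sum_bounded_above[of "{L..<2 * L}" "\<lambda>l. card (meets1 g n L l x)", OF card] by simp
  also have "\<dots> = nat L * (2 * nat ?q)" by simp
  also have "\<dots> \<le> n"
  proof -
    have q0: "?q \<ge> 0" using L by (simp add: pos_imp_zdiv_nonneg_iff)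
    have "4 * L * ?q \<le> int n" by (rule mult_div_le)
    moreover have "0 \<le> L * ?q" using L q0 by simp
    ultimately have "L * (2 * ?q) \<le> int n" by (simp add: mult.assoc)
    moreover have "int (nat L * (2 * nat ?q)) = L * (2 * ?q)" using L q0 by simp
    ultimately show ?thesis by linarith
  qed
  finally show ?thesis by (simp add: index1_def Torus)
next
  case Box
  have x': "x \<le> int n" using x by (simp add: side_def Box)
  have card: "card (meets1 g n L l x) \<le> 2 + ((if l = x then nat (4 * L) else 0) + (if l = int n - x then nat (4 * L) else 0))"
    if l: "l \<in> {L..<2 * L}" for l
  proof -
    let ?M = "{(x + 1) mod (4 * L), (x - l) mod (4 * L)}"
    let ?A = "if l = x then {4 * L..<8 * L} else {}" and ?B = "if l = int n - x then {8 * L..<12 * L} else {}"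
    have "meets1 g n L l x \<subseteq> ?M \<union> (?A \<union> ?B)"
    proof
      fix j assume "j \<in> meets1 g n L l x"
      then obtain a where j: "0 \<le> j" "j < 12 * L" and a: "a \<in> starts g n L l j" and d: "x = a - 1 \<or> x = a + l"
        by (auto simp: meets1_def index1_def per_def Box)
      consider "j < 4 * L" | "4 * L \<le> j" "j < 8 * L" | "8 * L \<le> j" by linarith
      then show "j \<in> ?M \<union> (?A \<union> ?B)"
      proof cases
        case 1
        then have "4 * L dvd a - j" using a by (simp add: starts_def Box)
        then have "a mod (4 * L) = j mod (4 * L)" by (simp add: mod_eq_dvd_iff)
        then have "a mod (4 * L) = j" using 1 j by simp
        then show ?thesis using d by auto
      next
        case 2
        then have "a = 0" using a by (simp add: starts_def Box)
        then show ?thesis using d 2 x by auto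
      next
        case 3
        then have "a = int n + 1 - l" using a L by (simp add: starts_def Box)
        then show ?thesis using d 3 x' j by auto
      qed
    qed
    then have "card (meets1 g n L l x) \<le> card (?M \<union> (?A \<union> ?B))" by (intro card_mono) auto
    also have "\<dots> \<le> card ?M + (card ?A + card ?B)"
      by (intro order_trans[OF card_Un_le] add_left_mono card_Un_le)
    also have "card ?M \<le> 2" using card_insert_le_m1[of 2 "{(x - l) mod (4 * L)}"] by simp
    finally show ?thesis by (auto split: if_splits)
  qed
  have "(\<Sum>l\<in>{L..<2 * L}. card (meets1 g n L l x))
      \<le> (\<Sum>l\<in>{L..<2 * L}. 2 + ((if l = x then nat (4 * L) else 0) + (if l = int n - x then nat (4 * L) else 0)))"
    by (rule sum_mono) (rule card)
  also have "\<dots> = (\<Sum>l\<in>{L..<2 * L}. 2) + ((\<Sum>l\<in>{L..<2 * L}. if l = x then nat (4 * L) else 0)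
      + (\<Sum>l\<in>{L..<2 * L}. if l = int n - x then nat (4 * L) else 0))"
    by (simp only: sum.distrib)
  also have "\<dots> \<le> 2 * nat L + (nat (4 * L) + nat (4 * L))"
    by (intro add_mono) (simp_all add: sum.delta sum.delta')
  also have "\<dots> \<le> nat (12 * L)" using L by linarith
  finally show ?thesis using L by (simp add: index1_def Box)
qed

end

section \<open>Random rounds of cubes\<close>

text \<open>A single length for all coordinates makes every block a cube. The families are chosen
  independently, so that counts factor over the coordinates.\<close>

definition rounds_index :: "geometry \<Rightarrow> nat \<Rightarrow> int \<Rightarrow> (int \<times> ('d \<Rightarrow> int)) set" where
  "rounds_index g n L = (SIGMA l:{L..<2 * L}. UNIV \<rightarrow>\<^sub>E index1 g n L)"

definition round_blocks :: "geometry \<Rightarrow> nat \<Rightarrow> int \<Rightarrow> int \<times> ('d \<Rightarrow> int) \<Rightarrow> 'd vertex set set" where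
  "round_blocks g n L s =
     (\<lambda>a. block g n a (fst s)) ` (\<Pi>\<^sub>E i\<in>UNIV. starts g n L (fst s) (snd s i))"

lemma finite_round_blocks: "finite (round_blocks g n L (s :: int \<times> (('d::finite) \<Rightarrow> int)))"
  unfolding round_blocks_def by (intro finite_imageI finite_PiE) (simp_all add: finite_starts)

context
  fixes L :: int and n :: nat
  assumes L: "1 \<le> L" and n: "4 * L \<le> int n"
begin

lemma finite_rounds_index: "finite (rounds_index g n L :: (int \<times> (('d::finite) \<Rightarrow> int)) set)"
  by (auto simp: rounds_index_def intro!: finite_SigmaI finite_PiE finite_index1)

lemma card_rounds_index:
  "card (rounds_index g n L :: (int \<times> (('d::finite) \<Rightarrow> int)) set) = nat L * card (index1 g n L) ^ CARD('d)"
  by (simp add: rounds_index_def card_SigmaI finite_PiE finite_index1 card_PiE)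

lemma index1_nonempty: "index1 g n L \<noteq> {}"
  using L n by (auto simp: index1_def split: geometry.split)

lemma rounds_index_nonempty: "(rounds_index g n L :: (int \<times> (('d::finite) \<Rightarrow> int)) set) \<noteq> {}"
proof -
  have "card (index1 g n L) > 0" using index1_nonempty finite_index1 by (simp add: card_gt_0_iff)
  then have "card (rounds_index g n L :: (int \<times> ('d \<Rightarrow> int)) set) > 0"
    using L by (simp add: card_rounds_index)
  then show ?thesis by (metis card.empty less_irrefl)
qed

lemma round_block_coord:
  assumes "x \<in> block g n a l \<union> ext_boundary (edges g n) (block g n a l)"
  shows "\<exists>t. - 1 \<le> t \<and> t \<le> l \<and> per g n dvd x i - a i - t"
  using assms
proof
  assume "x \<in> block g n a l"
  then obtain t where "0 \<le> t" "t < l" "per g n dvd x i - a i - t" by (auto simp: block_def)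
  then show ?thesis by (intro exI[of _ t]) auto
qed (rule ext_boundary_block(3))

text \<open>In each coordinate both offsets of the common vertex lie between -1 and
  \<open>l\<close>, so \<open>starts_separated\<close> identifies the corners.\<close>

lemma round_blocks_disjoint:
  assumes s: "s \<in> rounds_index g n L" and B: "B \<in> round_blocks g n L s" "B' \<in> round_blocks g n L s"
    and x: "x \<in> B \<union> ext_boundary (edges g n) B" "x \<in> B' \<union> ext_boundary (edges g n) B'"
  shows "B = B'"
proof -
  obtain l j where lj: "s = (l, j)" "L \<le> l" "l < 2 * L" using s by (auto simp: rounds_index_def)
  obtain a a' where a: "\<And>i. a i \<in> starts g n L l (j i)" "B = block g n a l"
    and a': "\<And>i. a' i \<in> starts g n L l (j i)" "B' = block g n a' l"
    using B by (auto simp: round_blocks_def lj PiE_iff)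
  have "a = a'"
  proof
    fix i
    obtain t where t: "- 1 \<le> t" "t \<le> l" "per g n dvd x i - a i - t"
      using round_block_coord[OF x(1)[unfolded a]] by blast
    obtain t' where t': "- 1 \<le> t'" "t' \<le> l" "per g n dvd x i - a' i - t'"
      using round_block_coord[OF x(2)[unfolded a']] by blast
    have "per g n dvd (x i - a' i - t') - (x i - a i - t)" using t'(3) t(3) by (rule dvd_diff)
    then have "per g n dvd a i - a' i - (t' - t)" by (simp add: algebra_simps)
    moreover have "\<bar>t' - t\<bar> \<le> l + 1" using t t' by linarith
    ultimately show "a i = a' i" using starts_separated[OF L n lj(2,3) a(1) a'(1)] by blast
  qed
  then show ?thesis using a a' by simp
qed

lemma round_blocks_in_cubes:
  assumes s: "s \<in> rounds_index g n L" and B: "B \<in> round_blocks g n L s"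
  shows "B \<in> cubes g n"
proof -
  obtain l j where lj: "s = (l, j)" "L \<le> l" "l < 2 * L" using s by (auto simp: rounds_index_def)
  obtain a where a: "\<And>i. a i \<in> starts g n L l (j i)" "B = block g n a l"
    using B by (auto simp: round_blocks_def lj PiE_iff)
  show ?thesis
    unfolding a(2)
  proof (rule block_in_cubes)
    show "\<forall>i. 0 \<le> a i \<and> a i + l \<le> int n + 1" if "g = Box"
      using starts_box[OF L n lj(2,3)] a(1) that by blast
  qed (use lj L n in auto)
qed

lemma round_blocks_subset: "B \<in> round_blocks g n L s \<Longrightarrow> B \<subseteq> verts g n"
  unfolding round_blocks_def using block_subset by blast

lemma round_blocks_near:
  assumes s: "s \<in> rounds_index g n L" and B: "B \<in> round_blocks g n L s"
    and w: "w \<in> B" and v: "v \<in> B \<union> ext_boundary (edges g n) B"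
  shows "(w, v) \<in> near g n (2 * L)"
proof -
  obtain l j where lj: "s = (l, j)" "L \<le> l" "l < 2 * L" using s by (auto simp: rounds_index_def)
  obtain a where a: "B = block g n a l" using B by (auto simp: round_blocks_def lj)
  show ?thesis
  proof (rule nearI)
    show "w \<in> verts g n" using w round_blocks_subset[OF B] by blast
    show "v \<in> verts g n" using v round_blocks_subset[OF B] ext_boundary_block(1) unfolding a by blast
    fix i
    obtain t where t: "0 \<le> t" "t < l" "per g n dvd w i - a i - t" using w unfolding a block_def by blast
    obtain t' where t': "- 1 \<le> t'" "t' \<le> l" "per g n dvd v i - a i - t'"
      using round_block_coord[OF v[unfolded a]] by blast
    have "\<bar>t' - t\<bar> \<le> 2 * L" using t t' lj by linarith
    then show "\<exists>t. \<bar>t\<bar> \<le> 2 * L \<and> per g n dvd v i - w i - t" using near_of_cong[OF t(3) t'(3)] by blast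
  qed
qed

text \<open>A vertex is covered once each of its coordinates is. For fixed \<open>l\<close> these
  choices are independent, and each contributes the factor 1/12 of
  \<open>card_covers1\<close>.\<close>

lemma rounds_cover:
  assumes u: "u \<in> verts g n"
  shows "(1 / 12) ^ CARD('d) * real (card (rounds_index g n L :: (int \<times> (('d::finite) \<Rightarrow> int)) set))
    \<le> real (card {s \<in> rounds_index g n L. (u :: 'd vertex) \<in> \<Union>(round_blocks g n L s)})"
proof -
  let ?I = "rounds_index g n L :: (int \<times> ('d \<Rightarrow> int)) set" and ?d = "CARD('d)"
  let ?X = "SIGMA l:{L..<2 * L}. (\<Pi>\<^sub>E i\<in>UNIV. covers1 g n L l (u i))"
  have sub: "?X \<subseteq> {s \<in> ?I. u \<in> \<Union>(round_blocks g n L s)}"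
  proof
    fix s assume "s \<in> ?X"
    then obtain l j where lj: "s = (l, j)" "L \<le> l" "l < 2 * L" "\<And>i. j i \<in> covers1 g n L l (u i)"
      by (auto simp: PiE_iff)
    have "s \<in> ?I" using lj by (auto simp: rounds_index_def covers1_def)
    have "\<forall>i. \<exists>a. a \<in> starts g n L l (j i) \<and> (\<exists>t. 0 \<le> t \<and> t < l \<and> per g n dvd u i - a - t)"
      using lj(4) unfolding covers1_def by blast
    from choice[OF this] obtain a where a: "\<forall>i. a i \<in> starts g n L l (j i) \<and>
        (\<exists>t. 0 \<le> t \<and> t < l \<and> per g n dvd u i - a i - t)" ..
    then have "u \<in> block g n a l" using u by (simp add: block_def)
    moreover have "block g n a l \<in> round_blocks g n L s" using a by (auto simp: round_blocks_def lj(1))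
    ultimately show "s \<in> {s \<in> ?I. u \<in> \<Union>(round_blocks g n L s)}" using \<open>s \<in> ?I\<close> by blast
  qed
  have "(1 / 12) ^ ?d * real (card ?I) = (\<Sum>l\<in>{L..<2 * L}. (real (card (index1 g n L)) / 12) ^ ?d)"
    using L by (simp add: card_rounds_index power_divide)
  also have "\<dots> \<le> (\<Sum>l\<in>{L..<2 * L}. \<Prod>i\<in>(UNIV :: 'd set). real (card (covers1 g n L l (u i))))"
  proof (rule sum_mono)
    fix l assume l: "l \<in> {L..<2 * L}"
    have "(\<Prod>i\<in>(UNIV :: 'd set). real (card (index1 g n L)) / 12) \<le> (\<Prod>i\<in>UNIV. real (card (covers1 g n L l (u i))))"
    proof (rule prod_mono)
      fix i
      have "0 \<le> u i" "u i < side g n" using u by (auto simp: in_verts)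
      then have "card (index1 g n L) \<le> 12 * card (covers1 g n L l (u i))"
        using l by (intro card_covers1[OF L n]) auto
      then show "0 \<le> real (card (index1 g n L)) / 12 \<and>
          real (card (index1 g n L)) / 12 \<le> real (card (covers1 g n L l (u i)))" by simp
    qed
    then show "(real (card (index1 g n L)) / 12) ^ ?d \<le> (\<Prod>i\<in>UNIV. real (card (covers1 g n L l (u i))))"
      by simp
  qed
  also have "\<dots> = real (card ?X)"
    by (simp add: card_SigmaI finite_PiE finite_covers1 card_PiE)
  also have "\<dots> \<le> real (card {s \<in> ?I. u \<in> \<Union>(round_blocks g n L s)})"
    using card_mono[OF finite_subset[OF Collect_restrict finite_rounds_index] sub] by (simp only: of_nat_le_iff)
  finally show ?thesis .
qed

text \<open>A boundary vertex lies just outside an interval in some coordinate, over which a union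
  bound is taken. For each coordinate, \<open>sum_card_meets1\<close> saves the factor
  \<open>L\<close>.\<close>

lemma rounds_boundary:
  assumes u: "u \<in> verts g n"
  shows "real (card {s \<in> rounds_index g n L. \<exists>C\<in>round_blocks g n L s.
      (u :: ('d::finite) vertex) \<in> ext_boundary (edges g n) C})
    \<le> CARD('d) / L * real (card (rounds_index g n L :: (int \<times> ('d \<Rightarrow> int)) set))"
proof -
  let ?I = "rounds_index g n L :: (int \<times> ('d \<Rightarrow> int)) set" and ?N = "card (index1 g n L)"
  let ?P = "\<lambda>i l i'. if i' = i then meets1 g n L l (u i) else index1 g n L"
  let ?Y = "\<lambda>i. SIGMA l:{L..<2 * L}. (\<Pi>\<^sub>E i'\<in>(UNIV :: 'd set). ?P i l i')"
  have finm: "finite (meets1 g n L l x)" for l x using finite_index1[of g n L] by (simp add: meets1_def)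
  have finP: "finite (?P i l i')" for i l i' using finm finite_index1 by simp
  have finY: "finite (?Y i)" for i using finP by (intro finite_SigmaI finite_PiE) auto
  have sub: "{s \<in> ?I. \<exists>C\<in>round_blocks g n L s. u \<in> ext_boundary (edges g n) C} \<subseteq> (\<Union>i. ?Y i)"
  proof
    fix s assume "s \<in> {s \<in> ?I. \<exists>C\<in>round_blocks g n L s. u \<in> ext_boundary (edges g n) C}"
    then obtain C where s: "s \<in> ?I" and C: "C \<in> round_blocks g n L s" "u \<in> ext_boundary (edges g n) C" by blast
    obtain l j where lj: "s = (l, j)" "L \<le> l" "l < 2 * L" "\<And>i. j i \<in> index1 g n L"
      using s by (auto simp: rounds_index_def PiE_iff)
    obtain a where a: "\<And>i. a i \<in> starts g n L l (j i)" "C = block g n a l"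
      using C by (auto simp: round_blocks_def lj PiE_iff)
    obtain i where "per g n dvd u i - (a i - 1) \<or> per g n dvd u i - (a i + l)"
      using ext_boundary_block(4)[OF C(2)[unfolded a(2)]] by blast
    then have "j i \<in> meets1 g n L l (u i)" unfolding meets1_def using a(1)[of i] lj(4)[of i] by blast
    then have "s \<in> ?Y i" using lj by (simp add: PiE_iff)
    then show "s \<in> (\<Union>i. ?Y i)" by blast
  qed
  have cardY: "card (?Y i) \<le> ?N ^ CARD('d)" for i
  proof -
    have "card (\<Pi>\<^sub>E i'\<in>(UNIV :: 'd set). ?P i l i') = card (meets1 g n L l (u i)) * ?N ^ (CARD('d) - 1)" for l
    proof -
      have "card (\<Pi>\<^sub>E i'\<in>(UNIV :: 'd set). ?P i l i') = (\<Prod>i'\<in>(UNIV :: 'd set). card (?P i l i'))"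
        by (simp add: card_PiE)
      also have "\<dots> = card (?P i l i) * (\<Prod>i'\<in>UNIV - {i}. card (?P i l i'))" by (intro prod.remove) auto
      also have "(\<Prod>i'\<in>UNIV - {i}. card (?P i l i')) = (\<Prod>i'\<in>UNIV - {i}. ?N)" by (intro prod.cong) auto
      also have "\<dots> = ?N ^ (CARD('d) - 1)" by simp
      finally show ?thesis by simp
    qed
    then have "card (?Y i) = (\<Sum>l\<in>{L..<2 * L}. card (meets1 g n L l (u i))) * ?N ^ (CARD('d) - 1)"
      using finP by (subst card_SigmaI) (simp_all add: finite_PiE sum_distrib_right)
    also have "\<dots> \<le> ?N * ?N ^ (CARD('d) - 1)"
      using sum_card_meets1[OF L n, of "u i" g] u by (intro mult_right_mono) (simp_all add: in_verts)
    also have "\<dots> = ?N ^ CARD('d)" by (simp flip: power_Suc)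
    finally show ?thesis .
  qed
  have "card {s \<in> ?I. \<exists>C\<in>round_blocks g n L s. u \<in> ext_boundary (edges g n) C} \<le> card (\<Union>i. ?Y i)"
    by (rule card_mono[OF finite_UN_I[OF finite finY] sub])
  also have "\<dots> \<le> (\<Sum>i\<in>UNIV. card (?Y i))" by (rule card_UN_le) simp
  also have "\<dots> \<le> CARD('d) * ?N ^ CARD('d)" using sum_bounded_above[of UNIV "\<lambda>i. card (?Y i)"] cardY by simp
  finally have "real (card {s \<in> ?I. \<exists>C\<in>round_blocks g n L s. u \<in> ext_boundary (edges g n) C})
      \<le> real (CARD('d) * ?N ^ CARD('d))" by (simp only: of_nat_le_iff)
  also have "\<dots> = CARD('d) / L * real (card ?I)" using L by (simp add: card_rounds_index)
  finally show ?thesis .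
qed

text \<open>The first term of \<open>\<theta>\<close> comes from the sites close to the
  disagreement, the second from total variation at distance at least \<open>r\<close>, times the
  block size. That size and the number of \<open>near\<close> neighbours are both bounded by
  \<open>m\<close>.\<close>

lemma block_rounds_exist:
  fixes S :: "'s set" and \<mu> :: "(('d::finite) vertex \<Rightarrow> 's) pmf" and a b :: real and r :: nat
  defines "m \<equiv> nat (4 * L + 1) ^ CARD('d)"
  defines "\<theta> \<equiv> 2 * real ((2 * r + 1) ^ CARD('d)) + real m * (b * exp (- a * real r))"
  assumes sys: "spin_system (verts g n) (edges g n) S \<mu> \<kappa>"
    and ab: "a > 0" "b > 0"
    and mixing: "\<And>\<Lambda> u \<psi> \<psi>' B. \<Lambda> \<in> cubes g n \<Longrightarrow> u \<in> ext_boundary (edges g n) \<Lambda> \<Longrightarrow>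
      \<psi> \<in> ext_boundary (edges g n) \<Lambda> \<rightarrow>\<^sub>E S \<Longrightarrow> \<psi>' \<in> ext_boundary (edges g n) \<Lambda> \<rightarrow>\<^sub>E S \<Longrightarrow>
      \<forall>v \<in> ext_boundary (edges g n) \<Lambda> - {u}. \<psi> v = \<psi>' v \<Longrightarrow> B \<subseteq> \<Lambda> \<Longrightarrow>
      total_variation (marginal B (\<kappa> \<Lambda> \<psi>)) (marginal B (\<kappa> \<Lambda> \<psi>'))
        \<le> b * exp (- a * real (graph_set_dist (edges g n) u B))"
    and \<rho>: "\<rho> > 0" "1 - (1 / 12) ^ CARD('d) + 2 * \<theta> * (CARD('d) / L) \<le> \<rho>"
  shows "\<exists>R. block_rounds (verts g n) (edges g n) S \<mu> \<kappa> (rounds_index g n L :: (int \<times> ('d \<Rightarrow> int)) set) R \<theta>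
    ((1 / 12) ^ CARD('d)) (CARD('d) / L) \<rho> (near g n (2 * L)) m"
proof -
  interpret spin_system "verts g n" "edges g n" S \<mu> \<kappa> by (rule sys)
  let ?I = "rounds_index g n L :: (int \<times> ('d \<Rightarrow> int)) set"
  have "\<forall>s. \<exists>xs. set xs = round_blocks g n L (s :: int \<times> ('d \<Rightarrow> int)) \<and> distinct xs"
    by (intro allI finite_distinct_list finite_round_blocks)
  from choice[OF this] obtain R where
    R: "\<And>s. set (R s) = round_blocks g n L (s :: int \<times> ('d \<Rightarrow> int))" "\<And>s. distinct (R s)" by blast
  have card_near: "card (near g n (2 * L) `` {v}) \<le> m" if "v \<in> verts g n" for v :: "'d vertex"
    using card_near_le[OF that, of "2 * L"] L by (simp add: m_def algebra_simps)
  have finite_near: "finite (near g n k `` {v})" for k and v :: "'d vertex"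
    by (rule finite_subset[OF _ finite_verts[of g n]]) (auto simp: near_def)
  have card_block: "card C \<le> m" if s: "s \<in> ?I" and C: "C \<in> round_blocks g n L s" for s C
  proof (cases "C = {}")
    case False
    then obtain w where w: "w \<in> C" by blast
    have "C \<subseteq> near g n (2 * L) `` {w}" using round_blocks_near[OF s C w] by blast
    then have "card C \<le> card (near g n (2 * L) `` {w})" using finite_near by (intro card_mono)
    also have "\<dots> \<le> m" using card_near w round_blocks_subset[OF C] by blast
    finally show ?thesis .
  qed simp
  have infl: "influence_le C u \<theta>"
    if s: "s \<in> ?I" and C: "C \<in> round_blocks g n L s" and u: "u \<in> ext_boundary (edges g n) C" for s C u
  proof -
    define B where "B = {v \<in> C. r \<le> graph_dist (edges g n) u v}"
    have CV: "C \<subseteq> verts g n" by (rule round_blocks_subset[OF C])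
    have uV: "u \<in> verts g n" using u bd_subset[of C] by blast
    have "C - B \<subseteq> near g n (int r) `` {u}"
    proof
      fix v assume v: "v \<in> C - B"
      have "(u, v) \<in> near g n (int (graph_dist (edges g n) u v))"
        using v CV uV by (intro graph_dist_near) auto
      moreover have "near g n (int (graph_dist (edges g n) u v)) \<subseteq> near g n (int r)"
        using v by (intro near_mono) (auto simp: B_def)
      ultimately show "v \<in> near g n (int r) `` {u}" by blast
    qed
    then have "card (C - B) \<le> card (near g n (int r) `` {u})" using finite_near by (intro card_mono)
    also have "\<dots> \<le> (2 * r + 1) ^ CARD('d)"
      using card_near_le[OF uV, of "int r"] by (simp add: nat_add_distrib nat_mult_distrib)
    finally have near: "real (card (C - B)) \<le> real ((2 * r + 1) ^ CARD('d))" by (simp only: of_nat_le_iff)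
    have "influence_le C u (2 * real ((2 * r + 1) ^ CARD('d)) + real (card B) * (b * exp (- a * real r)))"
    proof (rule influence_le_total_variation[OF CV u _ near])
      show "B \<subseteq> C" by (auto simp: B_def)
      fix \<psi> \<psi>'
      assume B: "B \<noteq> {}" and \<psi>: "\<psi> \<in> bd C \<rightarrow>\<^sub>E S" "\<psi>' \<in> bd C \<rightarrow>\<^sub>E S" "\<forall>v\<in>bd C - {u}. \<psi> v = \<psi>' v"
      \<comment> \<open>Nonemptiness matters: over the empty set the infimum would be 0.\<close>
      have "r \<le> graph_set_dist (edges g n) u B"
        unfolding graph_set_dist_def using B by (intro cINF_greatest) (auto simp: B_def)
      then have "b * exp (- a * real (graph_set_dist (edges g n) u B)) \<le> b * exp (- a * real r)"
        using ab by simp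
      moreover have "total_variation (marginal B (\<kappa> C \<psi>)) (marginal B (\<kappa> C \<psi>'))
          \<le> b * exp (- a * real (graph_set_dist (edges g n) u B))"
        by (rule mixing[OF round_blocks_in_cubes[OF s C] u \<psi> \<open>B \<subseteq> C\<close>])
      ultimately show "total_variation (marginal B (\<kappa> C \<psi>)) (marginal B (\<kappa> C \<psi>')) \<le> b * exp (- a * real r)"
        by linarith
    qed
    moreover have "2 * real ((2 * r + 1) ^ CARD('d)) + real (card B) * (b * exp (- a * real r)) \<le> \<theta>"
    proof -
      have "card B \<le> card C"
        using finite_subset[OF CV finite_verts] by (intro card_mono) (auto simp: B_def)
      then have "real (card B) \<le> real m" using card_block[OF s C] by simp
      then have "real (card B) * (b * exp (- a * real r)) \<le> real m * (b * exp (- a * real r))"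
        using ab by (intro mult_right_mono) auto
      then show ?thesis by (simp add: \<theta>_def)
    qed
    ultimately show ?thesis
      unfolding influence_le_def by (meson add_left_mono mult_right_mono osc_le_mono)
  qed
  have "block_rounds (verts g n) (edges g n) S \<mu> \<kappa> ?I R \<theta>
    ((1 / 12) ^ CARD('d)) (CARD('d) / L) \<rho> (near g n (2 * L)) m"
  proof (unfold_locales, unfold R(1))
    show "finite ?I" by (rule finite_rounds_index)
    show "?I \<noteq> {}" by (rule rounds_index_nonempty)
    show "C \<subseteq> verts g n" if "C \<in> round_blocks g n L s" for s C using that by (rule round_blocks_subset)
    show "C \<inter> ext_boundary (edges g n) C' = {}"
      if "s \<in> ?I" "C \<in> round_blocks g n L s" "C' \<in> round_blocks g n L s" for s C C'
    proof (rule equals0I)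
      fix x assume x: "x \<in> C \<inter> ext_boundary (edges g n) C'"
      then have "C = C'" using round_blocks_disjoint[OF that, of x] by blast
      then show False using x bd_subset[of C] by blast
    qed
    show "influence_le C u \<theta>" if "s \<in> ?I" "C \<in> round_blocks g n L s" "u \<in> ext_boundary (edges g n) C" for s C u
      using that by (rule infl)
    show "length (filter (\<lambda>C. u \<in> ext_boundary (edges g n) C) (R s)) \<le> 1" if s: "s \<in> ?I" for s u
    proof -
      let ?F = "filter (\<lambda>C. u \<in> ext_boundary (edges g n) C) (R s)"
      have "card (set ?F) \<le> Suc 0"
      proof (rule card_le_Suc0_iff_eq[THEN iffD2])
        show "\<forall>C\<in>set ?F. \<forall>C'\<in>set ?F. C = C'"
          using round_blocks_disjoint[OF s, of _ _ u] by (simp add: R(1))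
      qed simp
      then show ?thesis using distinct_card[of ?F] R(2) by simp
    qed
    show "(1 / 12) ^ CARD('d) * real (card ?I) \<le> real (card {s \<in> ?I. u \<in> \<Union>(round_blocks g n L s)})"
      if "u \<in> verts g n" for u using that by (rule rounds_cover)
    show "real (card {s \<in> ?I. \<exists>C\<in>round_blocks g n L s. u \<in> ext_boundary (edges g n) C})
        \<le> CARD('d) / L * real (card ?I)" if "u \<in> verts g n" for u using that by (rule rounds_boundary)
    show "0 \<le> \<theta>" using ab by (simp add: \<theta>_def)
    show "0 < \<rho>" "1 - (1 / 12) ^ CARD('d) + 2 * \<theta> * (CARD('d) / L) \<le> \<rho>" by (rule \<rho>)+
    show "near g n (2 * L) \<subseteq> verts g n \<times> verts g n" by (auto simp: near_def)
    show "Id_on (verts g n) \<subseteq> near g n (2 * L)" using L by (intro near_refl) auto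
    show "(w, v) \<in> near g n (2 * L)"
      if "s \<in> ?I" "C \<in> round_blocks g n L s" "w \<in> C" "v \<in> ext_boundary (edges g n) C" for s C w v
      using round_blocks_near[OF that(1-3)] that(4) by blast
    show "card ((near g n (2 * L))\<inverse> `` {v}) \<le> m" if v: "v \<in> verts g n" for v :: "'d vertex"
    proof -
      have "(near g n (2 * L))\<inverse> `` {v} \<subseteq> near g n (2 * L) `` {v}"
        using near_converse[of g n "2 * L"] by blast
      then have "card ((near g n (2 * L))\<inverse> `` {v}) \<le> card (near g n (2 * L) `` {v})"
        using finite_near by (intro card_mono)
      then show ?thesis using card_near[OF v] by linarith
    qed
    show "card C \<le> m" if "s \<in> ?I" "C \<in> round_blocks g n L s" for s C using that by (rule card_block)
  qed
  then show ?thesis by (rule exI[of _ R])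
qed

end

text \<open>The side length \<open>L = r ^ (d + 1)\<close> beats the \<open>O(r ^ d)\<close> vertices within distance \<open>r\<close> of the
  disagreement, while the decay in \<open>r\<close> beats the \<open>O(L ^ d)\<close> vertices of the block.\<close>

lemma exists_scale:
  fixes a b \<epsilon> :: real and d :: nat
  assumes "a > 0" "b > 0" "\<epsilon> > 0"
  obtains r L where "L = int (r ^ (d + 1))" "1 \<le> L"
    "(2 * real ((2 * r + 1) ^ d) + real (nat (4 * L + 1) ^ d) * (b * exp (- a * real r))) / L \<le> \<epsilon>"
proof -
  \<comment> \<open>The exponent of \<open>r\<close> in \<open>L ^ d\<close>. The constants 3 and 5
    below come from \<open>2 * r + 1 \<le> 3 * r\<close> and
    \<open>4 * L + 1 \<le> 5 * L\<close>.\<close>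
  let ?D = "(d + 1) * d"
  have l1: "(\<lambda>r::nat. 2 * 3 ^ d * (1 / real r)) \<longlonglongrightarrow> 0"
    by (rule tendsto_mult_right_zero) (rule lim_1_over_n)
  have at: "filterlim (\<lambda>r::nat. a * real r) at_top sequentially"
    by (rule filterlim_tendsto_pos_mult_at_top[OF tendsto_const assms(1) filterlim_real_sequentially])
  have l2: "(\<lambda>r::nat. 5 ^ d * b / a ^ ?D * ((a * real r) ^ ?D / exp (a * real r))) \<longlonglongrightarrow> 0"
    by (rule tendsto_mult_right_zero) (rule filterlim_compose[OF tendsto_power_div_exp_0 at])
  have "(\<lambda>r::nat. 2 * 3 ^ d * (1 / real r) + 5 ^ d * b / a ^ ?D * ((a * real r) ^ ?D / exp (a * real r))) \<longlonglongrightarrow> 0"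
    using tendsto_add[OF l1 l2] by simp
  then have "eventually (\<lambda>r::nat. 2 * 3 ^ d * (1 / real r)
      + 5 ^ d * b / a ^ ?D * ((a * real r) ^ ?D / exp (a * real r)) < \<epsilon>) sequentially"
    using assms(3) by (rule order_tendstoD)
  from eventually_conj[OF this eventually_ge_at_top[of 1]]
  obtain r :: nat where r: "r \<ge> 1" and lt: "2 * 3 ^ d * (1 / real r)
      + 5 ^ d * b / a ^ ?D * ((a * real r) ^ ?D / exp (a * real r)) < \<epsilon>"
    by (auto simp: eventually_sequentially)
  define l where "l = real r ^ (d + 1)"
  have l: "l \<ge> 1" unfolding l_def by (rule one_le_power) (use r in simp)
  have t1: "2 * real ((2 * r + 1) ^ d) / l \<le> 2 * 3 ^ d * (1 / real r)"
  proof -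
    have "real (2 * r + 1) ^ d \<le> (3 * real r) ^ d" by (rule power_mono) (use r in auto)
    then have "real ((2 * r + 1) ^ d) \<le> (3 * real r) ^ d" by (simp only: of_nat_power)
    then have "2 * real ((2 * r + 1) ^ d) / l \<le> 2 * (3 * real r) ^ d / l"
      using l by (intro divide_right_mono) auto
    also have "\<dots> = 2 * 3 ^ d * (1 / real r)" using r by (simp add: l_def power_mult_distrib)
    finally show ?thesis .
  qed
  have t2: "(4 * l + 1) ^ d * (b * exp (- a * real r)) / l
      \<le> 5 ^ d * b / a ^ ?D * ((a * real r) ^ ?D / exp (a * real r))"
  proof -
    have "(4 * l + 1) ^ d * (b * exp (- a * real r)) / l \<le> (5 * l) ^ d * (b * exp (- a * real r)) / 1"
      using l assms by (intro frac_le mult_right_mono power_mono) auto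
    also have "\<dots> = 5 ^ d * b / a ^ ?D * ((a * real r) ^ ?D / exp (a * real r))"
      using assms by (simp add: power_mult_distrib l_def exp_minus field_simps power_add flip: power_mult)
    finally show ?thesis .
  qed
  show thesis
  proof (rule that[of "int (r ^ (d + 1))" r])
    show "1 \<le> int (r ^ (d + 1))" using r by (simp add: one_le_power del: of_nat_power power_Suc)
    have "real (nat (4 * int (r ^ (d + 1)) + 1) ^ d) = (4 * l + 1) ^ d"
      by (simp add: l_def nat_add_distrib nat_mult_distrib nat_power_eq add.commute del: power_Suc)
    moreover have "real_of_int (int (r ^ (d + 1))) = l" by (simp add: l_def)
    ultimately show "(2 * real ((2 * r + 1) ^ d) + real (nat (4 * int (r ^ (d + 1)) + 1) ^ d) * (b * exp (- a * real r)))
        / real_of_int (int (r ^ (d + 1))) \<le> \<epsilon>"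
      using t1 t2 lt by (simp only: add_divide_distrib)
  qed simp
qed

section \<open>Choice of the constants and conclusion\<close>

theorem theorem1p10:
  fixes g :: geometry
    and S :: "'s set"
    and \<mu> :: "nat \<Rightarrow> (('d::finite) vertex \<Rightarrow> 's) pmf"
  assumes "finite S"
    and "\<And>n. n \<ge> 1 \<Longrightarrow> set_pmf (\<mu> n) \<subseteq> verts g n \<rightarrow>\<^sub>E S"
    and "\<And>n. n \<ge> 1 \<Longrightarrow> spatial_markov (verts g n) (edges g n) S (\<mu> n)"
    and "strong_spatial_mixing g S \<mu>"
  shows "\<not> random_sparse_reconstruction (verts g) S \<mu>"
proof
  assume "random_sparse_reconstruction (verts g) S \<mu>"
  then obtain f \<U> c where c: "c > 0"
    and \<U>: "\<And>n. n \<ge> 1 \<Longrightarrow> set_pmf (\<U> n) \<subseteq> Pow (verts g n)"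
    and revealment: "(\<lambda>n. revealment (verts g n) (\<U> n)) \<longlonglongrightarrow> 0"
    and clue: "\<And>n. n \<ge> 1 \<Longrightarrow> measure_pmf.expectation (\<U> n) (clue (\<mu> n) (f n)) > c"
    unfolding random_sparse_reconstruction_def by blast
  obtain \<kappa> a b where laws: "\<And>n. n \<ge> 1 \<Longrightarrow> boundary_laws (verts g n) (edges g n) S (\<mu> n) (\<kappa> n)"
    and ab: "a > 0" "b > 0"
    and mixing: "\<And>n \<Lambda> u \<psi> \<psi>' B. n \<ge> 1 \<Longrightarrow> \<Lambda> \<in> cubes g n \<Longrightarrow> u \<in> ext_boundary (edges g n) \<Lambda> \<Longrightarrow>
      \<psi> \<in> ext_boundary (edges g n) \<Lambda> \<rightarrow>\<^sub>E S \<Longrightarrow> \<psi>' \<in> ext_boundary (edges g n) \<Lambda> \<rightarrow>\<^sub>E S \<Longrightarrow>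
      \<forall>v \<in> ext_boundary (edges g n) \<Lambda> - {u}. \<psi> v = \<psi>' v \<Longrightarrow> B \<subseteq> \<Lambda> \<Longrightarrow>
      total_variation (marginal B (\<kappa> n \<Lambda> \<psi>)) (marginal B (\<kappa> n \<Lambda> \<psi>'))
        \<le> b * exp (- a * real (graph_set_dist (edges g n) u B))"
    using assms(4) unfolding strong_spatial_mixing_def by metis
  define d where "d = CARD('d)"
  have d: "d > 0" by (simp add: d_def)
  define \<alpha> :: real where "\<alpha> = (1 / 12) ^ d"
  have \<alpha>: "0 < \<alpha>" "\<alpha> \<le> 1" by (simp_all add: \<alpha>_def power_le_one)
  \<comment> \<open>The target \<open>\<alpha> / (4 * d)\<close> makes the loss
    \<open>2 * \<theta> * (d / L)\<close> at most half of the gain \<open>\<alpha>\<close>, whence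
    \<open>\<rho> = 1 - \<alpha> / 2\<close>.\<close>
  obtain r L where L: "1 \<le> L" and scale:
    "(2 * real ((2 * r + 1) ^ d) + real (nat (4 * L + 1) ^ d) * (b * exp (- a * real r))) / L \<le> \<alpha> / (4 * d)"
    using exists_scale[OF ab, of "\<alpha> / (4 * d)" d] \<alpha> d by (metis divide_pos_pos mult_pos_pos of_nat_0_less_iff zero_less_numeral)
  define m where "m = nat (4 * L + 1) ^ d"
  define \<theta> where "\<theta> = 2 * real ((2 * r + 1) ^ d) + real m * (b * exp (- a * real r))"
  define \<rho> where "\<rho> = 1 - \<alpha> / 2"
  have \<rho>: "0 < \<rho>" "\<rho> < 1" using \<alpha> by (simp_all add: \<rho>_def)
  have rate: "1 - \<alpha> + 2 * \<theta> * (d / L) \<le> \<rho>"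
  proof -
    have "2 * d * (\<theta> / L) \<le> 2 * d * (\<alpha> / (4 * d))"
      using scale by (intro mult_left_mono) (simp_all add: \<theta>_def m_def)
    then show ?thesis using d by (simp add: \<rho>_def field_simps)
  qed
  \<comment> \<open>\<open>T\<close>, and with it \<open>M\<close>, is fixed before
    \<open>n\<close>. Then \<open>n\<close> is taken so large that the revealment term also drops
    below \<open>c / 2\<close> and that \<open>4 * L \<le> n\<close>, as the rounds require.\<close>
  obtain T where T: "\<rho> ^ T < c / 2" using real_arch_pow_inv[of "c / 2" \<rho>] c \<rho> by auto
  define M where "M = real (m ^ Suc T)"
  have "(\<lambda>n. M * revealment (verts g n) (\<U> n)) \<longlonglongrightarrow> 0"
    using revealment by (rule tendsto_mult_right_zero)
  then have "eventually (\<lambda>n. M * revealment (verts g n) (\<U> n) < c / 2) sequentially"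
    using c by (intro order_tendstoD) auto
  from eventually_conj[OF this eventually_ge_at_top[of "nat (4 * L)"]]
  obtain n where small: "M * revealment (verts g n) (\<U> n) < c / 2" and "n \<ge> nat (4 * L)"
    by (auto simp: eventually_sequentially)
  then have n: "4 * L \<le> int n" "n \<ge> 1" using L by linarith+
  let ?V = "verts g n :: 'd vertex set"
  have sys: "spin_system ?V (edges g n) S (\<mu> n) (\<kappa> n)"
    using assms(1) assms(2,3)[OF n(2)] laws[OF n(2)] finite_verts[of g n] edges_subset[of g n]
    by unfold_locales
  let ?I = "rounds_index g n L :: (int \<times> ('d \<Rightarrow> int)) set"
  obtain R where "block_rounds ?V (edges g n) S (\<mu> n) (\<kappa> n) ?I R \<theta> \<alpha> (d / L) \<rho>
      (near g n (2 * L)) m"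
    using block_rounds_exist[OF L n(1) sys ab mixing[OF n(2)] \<rho>(1), of r] rate
    unfolding \<theta>_def m_def \<alpha>_def d_def by blast
  then interpret block_rounds ?V "edges g n" S "\<mu> n" "\<kappa> n" ?I R \<theta> \<alpha> "d / L" \<rho>
      "near g n (2 * L)" m .
  let ?\<delta> = "revealment ?V (\<U> n)"
  have \<delta>: "measure_pmf.prob (\<U> n) {U. j \<in> U} \<le> ?\<delta>" if "j \<in> ?V" for j
    unfolding revealment_def by (intro Max_ge finite_imageI finite_verts imageI that)
  have "(\<lambda>_. 0) \<in> ?V" using L n by (simp add: in_verts side_def split: geometry.split)
  then have "0 \<le> ?\<delta>" using \<delta> measure_nonneg order_trans by blast
  have "measure_pmf.expectation (\<U> n) (clue (\<mu> n) (f n)) \<le> M * ?\<delta> + \<rho> ^ T"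
    unfolding M_def by (rule expected_clue_le[OF \<U>[OF n(2)] \<delta> \<open>0 \<le> ?\<delta>\<close>])
  with clue[OF n(2)] small T show False by simp
qed

end
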